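(* (Prime Decomposition Theorem.) Let $(G,\sigma)$ be a connected signed graph and let $D$ be the prime decomposition of the graph $G$. Then $(G,\sigma)$ admits a prime $s$-decomposition $D_s$, which is unique up to the order of the factors and up to replacing each factor by an equivalent signed graph. Moreover, viewing $D_s$ (by forgetting signatures) as a decomposition of $G$, $D$ is finer than $D_s$.
   Context: A signed graph $(G,\sigma)$ is a simple loopless undirected graph with a signature $\sigma:E(G)\to\{+1,-1\}$. Switching a vertex negates the signs of its incident edges. Two signed graphs $(G,\sigma)$ and $(H,\pi)$ are equivalent, written $(G,\sigma)\equiv(H,\pi)$, if there is a graph isomorphism $G\to H$ carrying $\sigma$ to a signature obtained from $\pi$ by switching a set of vertices. The Cartesian product $(G,\sigma)\,\square\,(H,\pi)$ is the signed graph on $G\,\square\,H$ where $(u,v_1)(u,v_2)$ has sign $\pi(v_1v_2)$ and $(u_1,v)(u_2,v)$ has sign $\sigma(u_1u_2)$. A signed graph is $s$-prime if it is not equivalent to $(A,\pi_A)\,\square\,(B,\pi_B)$ for any signed graphs $(A,\pi_A),(B,\pi_B)$ each with at least two vertices. An $s$-decomposition of a connected signed graph $(G,\sigma)$ is a multiset $\{(G_1,\pi_1),\dots,(G_k,\pi_k)\}$, $k\ge1$, of signed graphs each with at least one edge such that $(G,\sigma)\equiv(G_1,\pi_1)\,\square\cdots\square\,(G_k,\pi_k)$; it is prime if all factors are $s$-prime. For ordinary graphs, a graph is prime if it is not $A\,\square\,B$ with $A,B$ on at least two vertices; a decomposition of $G$ is a multiset $\{G_1,\dots,G_k\}$ of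 graphs with at least one edge with $G\cong G_1\,\square\cdots\square\,G_k$, prime if all $G_i$ are prime (the prime decomposition of a connected graph is unique up to isomorphism and order). A decomposition $D'$ is finer than $D=\{G_1,\dots,G_k\}$ if each $G_i$ has a decomposition $\{G'_{i,1},\dots,G'_{i,p_i}\}$ and $D'$ is the union of these multisets. *)

theory Defs
  imports Main "HOL-Library.Multiset"
begin

text \<open>A graph is a pair (V, E) of a vertex set and a set of edges, each edge being a
  two-element set of vertices. A signed graph additionally carries a signature on edges
  (values +1 / -1; values outside the edge set are irrelevant).\<close>

type_synonym 'a graph = "'a set \<times> 'a set set"
type_synonym 'a sgraph = "'a graph \<times> ('a set \<Rightarrow> int)"

definition gverts :: "'a graph \<Rightarrow> 'a set" where "gverts G = fst G"
definition gedges :: "'a graph \<Rightarrow> 'a set set" where "gedges G = snd G"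

definition ugraph :: "'a sgraph \<Rightarrow> 'a graph" where "ugraph S = fst S"
definition sgn :: "'a sgraph \<Rightarrow> 'a set \<Rightarrow> int" where "sgn S = snd S"

text \<open>Finite simple loopless undirected graph.\<close>
definition wf_graph :: "'a graph \<Rightarrow> bool" where
  "wf_graph G \<longleftrightarrow> finite (gverts G) \<and>
     (\<forall>e\<in>gedges G. \<exists>u v. u \<noteq> v \<and> u \<in> gverts G \<and> v \<in> gverts G \<and> e = {u, v})"

definition wf_sgraph :: "'a sgraph \<Rightarrow> bool" where
  "wf_sgraph S \<longleftrightarrow> wf_graph (ugraph S) \<and> (\<forall>e\<in>gedges (ugraph S). sgn S e \<in> {1, -1})"

definition connected_graph :: "'a graph \<Rightarrow> bool" where
  "connected_graph G \<longleftrightarrow> gverts G \<noteq> {} \<and>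
     (\<forall>u\<in>gverts G. \<forall>v\<in>gverts G. (u, v) \<in> {(x, y). {x, y} \<in> gedges G}\<^sup>*)"

definition graph_iso :: "('a \<Rightarrow> 'b) \<Rightarrow> 'a graph \<Rightarrow> 'b graph \<Rightarrow> bool" where
  "graph_iso f G H \<longleftrightarrow> bij_betw f (gverts G) (gverts H) \<and>
     (\<forall>u\<in>gverts G. \<forall>v\<in>gverts G. {u, v} \<in> gedges G \<longleftrightarrow> {f u, f v} \<in> gedges H)"

definition isomorphic :: "'a graph \<Rightarrow> 'b graph \<Rightarrow> bool" where
  "isomorphic G H \<longleftrightarrow> (\<exists>f. graph_iso f G H)"

text \<open>Switching the vertex set X negates the signs of edges with exactly one end in X.\<close>
definition switch :: "'a set \<Rightarrow> ('a set \<Rightarrow> int) \<Rightarrow> 'a set \<Rightarrow> int" where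
  "switch X \<pi> e = (if card (e \<inter> X) = 1 then - \<pi> e else \<pi> e)"

definition s_equiv :: "'a sgraph \<Rightarrow> 'b sgraph \<Rightarrow> bool" where
  "s_equiv S T \<longleftrightarrow> (\<exists>f X. graph_iso f (ugraph S) (ugraph T) \<and> X \<subseteq> gverts (ugraph T) \<and>
     (\<forall>e\<in>gedges (ugraph S). sgn S e = switch X (sgn T) (f ` e)))"

text \<open>Cartesian product of a list of graphs (vertices are tuples, encoded as lists).\<close>
definition prod_verts :: "'a graph list \<Rightarrow> 'a list set" where
  "prod_verts Gs = {xs. length xs = length Gs \<and> (\<forall>i<length Gs. xs ! i \<in> gverts (Gs ! i))}"

definition prod_step :: "'a graph list \<Rightarrow> nat \<Rightarrow> 'a list \<Rightarrow> 'a list \<Rightarrow> bool" where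
  "prod_step Gs i xs ys \<longleftrightarrow> xs \<in> prod_verts Gs \<and> ys \<in> prod_verts Gs \<and> i < length Gs \<and>
     {xs ! i, ys ! i} \<in> gedges (Gs ! i) \<and> (\<forall>j<length Gs. j \<noteq> i \<longrightarrow> xs ! j = ys ! j)"

definition gprod_list :: "'a graph list \<Rightarrow> 'a list graph" where
  "gprod_list Gs = (prod_verts Gs, {{xs, ys} | xs ys. \<exists>i. prod_step Gs i xs ys})"

definition sprod_list :: "'a sgraph list \<Rightarrow> 'a list sgraph" where
  "sprod_list Ss = (gprod_list (map ugraph Ss),
     (\<lambda>e. SOME s. \<exists>xs ys i. e = {xs, ys} \<and> prod_step (map ugraph Ss) i xs ys \<and>
                   s = sgn (Ss ! i) {xs ! i, ys ! i}))"

text \<open>Primality (factors are taken, without loss of generality, on vertex type nat).\<close>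
definition prime_graph :: "'a graph \<Rightarrow> bool" where
  "prime_graph G \<longleftrightarrow> \<not> (\<exists>A B :: nat graph. wf_graph A \<and> wf_graph B \<and>
      card (gverts A) \<ge> 2 \<and> card (gverts B) \<ge> 2 \<and> isomorphic G (gprod_list [A, B]))"

definition s_prime :: "'a sgraph \<Rightarrow> bool" where
  "s_prime S \<longleftrightarrow> \<not> (\<exists>A B :: nat sgraph. wf_sgraph A \<and> wf_sgraph B \<and>
      card (gverts (ugraph A)) \<ge> 2 \<and> card (gverts (ugraph B)) \<ge> 2 \<and>
      s_equiv S (sprod_list [A, B]))"

text \<open>Decompositions: nonempty multisets of factors, each with at least one edge.\<close>
definition graph_decomp :: "'a graph \<Rightarrow> nat graph multiset \<Rightarrow> bool" where
  "graph_decomp G D \<longleftrightarrow> D \<noteq> {#} \<and> (\<forall>H\<in>#D. wf_graph H \<and> gedges H \<noteq> {}) \<and>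
     (\<exists>xs. mset xs = D \<and> isomorphic G (gprod_list xs))"

definition prime_graph_decomp :: "'a graph \<Rightarrow> nat graph multiset \<Rightarrow> bool" where
  "prime_graph_decomp G D \<longleftrightarrow> graph_decomp G D \<and> (\<forall>H\<in>#D. prime_graph H)"

definition s_decomp :: "'a sgraph \<Rightarrow> nat sgraph multiset \<Rightarrow> bool" where
  "s_decomp S D \<longleftrightarrow> D \<noteq> {#} \<and> (\<forall>H\<in>#D. wf_sgraph H \<and> gedges (ugraph H) \<noteq> {}) \<and>
     (\<exists>xs. mset xs = D \<and> s_equiv S (sprod_list xs))"

definition prime_s_decomp :: "'a sgraph \<Rightarrow> nat sgraph multiset \<Rightarrow> bool" where
  "prime_s_decomp S D \<longleftrightarrow> s_decomp S D \<and> (\<forall>H\<in>#D. s_prime H)"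

text \<open>D' is finer than D: each factor of D has a decomposition, and D' is the union
  (multiset sum) of these decompositions.\<close>
definition finer :: "nat graph multiset \<Rightarrow> nat graph multiset \<Rightarrow> bool" where
  "finer D' D \<longleftrightarrow> (\<exists>Gs ds. mset Gs = D \<and> length ds = length Gs \<and>
     (\<forall>i<length Gs. graph_decomp (Gs ! i) (ds ! i)) \<and> sum_list ds = D')"

end

theory Submission
  imports Defs
begin

text \<open>Fix an isomorphism, up to switching, between two Cartesian products and a base vertex. A layer
  (all vertices differing from the base vertex in one given coordinate at most) is connected and
  contains every common neighbour of two of its vertices. These properties are preserved by
  isomorphisms, and a nonempty set of vertices of a product that has them is a box, that is, a
  product of subsets of the factors. Hence the layer of an \<open>s\<close>-prime factor of one product is mapped
  into a single layer of the other one. If all factors on both sides are \<open>s\<close>-prime, the argument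
  works in both directions and the layers, hence the factors, correspond bijectively. If only the
  factors on the one side are prime, each factor on the other side is the product of the prime
  factors whose layers it contains; for ordinary graphs, which are treated as signed graphs with
  all signs positive, this is the refinement claim. Existence follows by induction on the number
  of vertices.\<close>

text \<open>A box splits an \<open>s\<close>-prime factor together with its signs because the sign
  of an edge in a product depends only on the two entries in the coordinate that changes. The signs
  on a layer are therefore read in the target product, where parallel edges agree exactly, and the
  switching function restricted to the layer translates them back to the factor. The two properties
  of a layer need each other: three vertices of a square are connected but miss a common neighbour,
  while two vertices at distance at least three satisfy the closure condition vacuously. Graph
  coordinates need not split a signed graph: the four-cycle with one negative edge is
  \<open>s\<close>-prime although its graph is a product of two edges, since opposite edges of a
  square in a signed product have equal signs. This is why the signed prime factors can be coarser
  than those of the graph, and why the refinement claim has a direction.\<close>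

abbreviation sverts :: "'a sgraph \<Rightarrow> 'a set" where "sverts S \<equiv> gverts (ugraph S)"
abbreviation sedges :: "'a sgraph \<Rightarrow> 'a set set" where "sedges S \<equiv> gedges (ugraph S)"

section \<open>Edges, isomorphisms and connectedness of graphs\<close>

lemma wf_graph_edgeD:
  assumes "wf_graph G" "{u, v} \<in> gedges G"
  shows "u \<noteq> v" "u \<in> gverts G" "v \<in> gverts G"
proof -
  obtain x y where "x \<noteq> y" "x \<in> gverts G" "y \<in> gverts G" "{u, v} = {x, y}"
    using assms unfolding wf_graph_def by blast
  then show "u \<noteq> v" "u \<in> gverts G" "v \<in> gverts G" by (auto simp: doubleton_eq_iff)
qed

lemma wf_graph_edgeE:
  assumes "wf_graph G" "e \<in> gedges G"
  obtains u v where "e = {u, v}" "u \<noteq> v" "u \<in> gverts G" "v \<in> gverts G"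
  using assms unfolding wf_graph_def by blast

lemma wf_sgraph_wf_graph: "wf_sgraph S \<Longrightarrow> wf_graph (ugraph S)"
  by (simp add: wf_sgraph_def)

lemma graph_iso_edge_iff:
  "\<lbrakk>graph_iso f G H; u \<in> gverts G; v \<in> gverts G\<rbrakk> \<Longrightarrow> {f u, f v} \<in> gedges H \<longleftrightarrow> {u, v} \<in> gedges G"
  by (simp add: graph_iso_def)

lemma graph_iso_mem: "\<lbrakk>graph_iso f G H; u \<in> gverts G\<rbrakk> \<Longrightarrow> f u \<in> gverts H"
  by (auto simp: graph_iso_def bij_betw_def)

lemma graph_iso_inj: "graph_iso f G H \<Longrightarrow> inj_on f (gverts G)"
  by (auto simp: graph_iso_def bij_betw_def)

lemma graph_iso_inv:
  assumes "graph_iso f G H"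
  shows "graph_iso (inv_into (gverts G) f) H G"
proof -
  have b: "bij_betw f (gverts G) (gverts H)" using assms by (simp add: graph_iso_def)
  have "{u, v} \<in> gedges H \<longleftrightarrow> {inv_into (gverts G) f u, inv_into (gverts G) f v} \<in> gedges G"
    if "u \<in> gverts H" "v \<in> gverts H" for u v
    using graph_iso_edge_iff[OF assms, of "inv_into (gverts G) f u" "inv_into (gverts G) f v"] that b
    by (simp add: bij_betw_def f_inv_into_f inv_into_into)
  then show ?thesis using bij_betw_inv_into[OF b] by (simp add: graph_iso_def)
qed

lemma graph_iso_comp:
  assumes "graph_iso f G H" "graph_iso g H K"
  shows "graph_iso (g \<circ> f) G K"
  using assms graph_iso_mem[OF assms(1)] bij_betw_trans[of f "gverts G" "gverts H" g "gverts K"]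
  by (simp add: graph_iso_def)

lemma connected_graph_iso:
  assumes "graph_iso f G H" "wf_graph G" "connected_graph G"
  shows "connected_graph H"
proof -
  have im: "gverts H = f ` gverts G" using assms(1) by (auto simp: graph_iso_def bij_betw_def)
  have walk: "(f u, f v) \<in> {(x, y). {x, y} \<in> gedges H}\<^sup>*"
    if "(u, v) \<in> {(x, y). {x, y} \<in> gedges G}\<^sup>*" for u v
    using that
  proof (induction rule: rtrancl_induct)
    case (step y z)
    then have "{f y, f z} \<in> gedges H"
      using wf_graph_edgeD[OF assms(2)] graph_iso_edge_iff[OF assms(1)] by auto
    then show ?case using step.IH by (simp add: rtrancl.rtrancl_into_rtrancl)
  qed simp
  show ?thesis using assms(3) walk unfolding connected_graph_def im by auto
qed

text \<open>Failure of primality yields factors with at least two vertices, whereas a decomposition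
  asks for factors with an edge; connectedness bridges the two conditions.\<close>

lemma connected_graph_edges:
  assumes "connected_graph G" "card (gverts G) \<ge> 2"
  shows "gedges G \<noteq> {}"
proof
  assume e: "gedges G = {}"
  have "\<not> (\<exists>a. gverts G \<subseteq> {a})"
    using assms(2) card_mono[of "{a}" "gverts G" for a] by fastforce
  then obtain u v where "u \<in> gverts G" "v \<in> gverts G" "u \<noteq> v" by blast
  then have "(u, v) \<in> {(x, y). {x, y} \<in> gedges G}\<^sup>*"
    using assms(1) by (simp add: connected_graph_def)
  then show False using e \<open>u \<noteq> v\<close> by simp
qed

subsection \<open>Switching equivalence\<close>

text \<open>The sign function \<open>h\<close> is \<open>-1\<close> on the switched vertices, so that switching becomes
  multiplication by \<open>h u * h v\<close> on the edge \<open>{u, v}\<close>.\<close>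

definition equiv_via :: "('a \<Rightarrow> 'b) \<Rightarrow> ('a \<Rightarrow> int) \<Rightarrow> 'a sgraph \<Rightarrow> 'b sgraph \<Rightarrow> bool" where
  "equiv_via f h S T \<longleftrightarrow> graph_iso f (ugraph S) (ugraph T) \<and> (\<forall>u\<in>sverts S. h u \<in> {1, -1}) \<and>
     (\<forall>u v. {u, v} \<in> sedges S \<longrightarrow> sgn S {u, v} = h u * h v * sgn T {f u, f v})"

lemma equiv_via_iso: "equiv_via f h S T \<Longrightarrow> graph_iso f (ugraph S) (ugraph T)"
  by (simp add: equiv_via_def)

lemma switch_doubleton:
  "u \<noteq> v \<Longrightarrow> switch X t {u, v} = (if u \<in> X then -1 else 1) * (if v \<in> X then -1 else 1) * t {u, v}"
  by (auto simp: switch_def Int_insert_left)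

text \<open>The switched set \<open>X\<close> lives on the side of \<open>T\<close>, the sign
  function \<open>h\<close> on the side of \<open>S\<close>. They determine each other by
  \<open>h u = -1\<close> iff \<open>f u \<in> X\<close>, where injectivity of \<open>f\<close> on
  the vertices makes the passage from \<open>h\<close> to \<open>X\<close> faithful.\<close>

lemma s_equiv_iff_equiv_via:
  assumes "wf_sgraph S"
  shows "s_equiv S T \<longleftrightarrow> (\<exists>f h. equiv_via f h S T)"
proof
  note wf = wf_sgraph_wf_graph[OF assms]
  assume "s_equiv S T"
  then obtain f X where f: "graph_iso f (ugraph S) (ugraph T)"
    and s: "\<And>e. e \<in> sedges S \<Longrightarrow> sgn S e = switch X (sgn T) (f ` e)"
    unfolding s_equiv_def by blast
  have "equiv_via f (\<lambda>u. if f u \<in> X then -1 else 1) S T"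
    unfolding equiv_via_def
  proof (intro conjI allI impI f)
    fix u v assume e: "{u, v} \<in> sedges S"
    have "f u \<noteq> f v" using wf_graph_edgeD[OF wf e] graph_iso_inj[OF f] by (auto dest: inj_onD)
    then show "sgn S {u, v} = (if f u \<in> X then -1 else 1) * (if f v \<in> X then -1 else 1) * sgn T {f u, f v}"
      using s[OF e] switch_doubleton[of "f u" "f v" X "sgn T"] by simp
  qed auto
  then show "\<exists>f h. equiv_via f h S T" by blast
next
  note wf = wf_sgraph_wf_graph[OF assms]
  assume "\<exists>f h. equiv_via f h S T"
  then obtain f h where v: "equiv_via f h S T" by blast
  note f = equiv_via_iso[OF v]
  let ?X = "f ` {u \<in> sverts S. h u = -1}"
  have X: "(if f u \<in> ?X then -1 else 1) = h u" if "u \<in> sverts S" for u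
    using v that graph_iso_inj[OF f] unfolding equiv_via_def by (auto dest: inj_onD)
  have "sgn S e = switch ?X (sgn T) (f ` e)" if e: "e \<in> sedges S" for e
  proof -
    obtain u v where uv: "e = {u, v}" "u \<noteq> v" "u \<in> sverts S" "v \<in> sverts S"
      using wf_graph_edgeE[OF wf e] by blast
    have "f u \<noteq> f v" using uv graph_iso_inj[OF f] by (auto dest: inj_onD)
    then have "switch ?X (sgn T) (f ` e) = h u * h v * sgn T {f u, f v}"
      using switch_doubleton[of "f u" "f v" ?X "sgn T"] X uv by simp
    then show ?thesis using v e uv(1) by (simp add: equiv_via_def)
  qed
  moreover have "?X \<subseteq> sverts T" using graph_iso_mem[OF f] by auto
  ultimately show "s_equiv S T" unfolding s_equiv_def using f by blast
qed

text \<open>A sign is its own inverse, so the same sign function, pulled back along the inverse map,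
  undoes the switching.\<close>

lemma equiv_via_sym:
  assumes "equiv_via f h S T" "wf_graph (ugraph T)"
  shows "equiv_via (inv_into (sverts S) f) (h \<circ> inv_into (sverts S) f) T S"
proof -
  note f = equiv_via_iso[OF assms(1)]
  let ?g = "inv_into (sverts S) f"
  note g = graph_iso_inv[OF f]
  have h: "h u \<in> {1, -1}" if "u \<in> sverts S" for u using assms(1) that by (simp add: equiv_via_def)
  have "sgn T {x, y} = (h \<circ> ?g) x * (h \<circ> ?g) y * sgn S {?g x, ?g y}" if e: "{x, y} \<in> sedges T" for x y
  proof -
    note xy = wf_graph_edgeD[OF assms(2) e]
    have fg: "f (?g x) = x" "f (?g y) = y"
      using xy f by (auto simp: graph_iso_def bij_betw_def intro: f_inv_into_f)
    have "{?g x, ?g y} \<in> sedges S" using e graph_iso_edge_iff[OF g] xy by simp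
    then have "sgn S {?g x, ?g y} = h (?g x) * h (?g y) * sgn T {x, y}"
      using assms(1) fg unfolding equiv_via_def by metis
    then show ?thesis using h[of "?g x"] h[of "?g y"] graph_iso_mem[OF g] xy by auto
  qed
  then show ?thesis using g h graph_iso_mem[OF g] by (simp add: equiv_via_def)
qed

lemma equiv_via_trans:
  assumes "equiv_via f h S T" "equiv_via g k T U" "wf_graph (ugraph S)"
  shows "equiv_via (g \<circ> f) (\<lambda>u. h u * k (f u)) S U"
proof -
  note f = equiv_via_iso[OF assms(1)]
  have "sgn S {u, v} = (h u * k (f u)) * (h v * k (f v)) * sgn U {g (f u), g (f v)}"
    if e: "{u, v} \<in> sedges S" for u v
  proof -
    have "{f u, f v} \<in> sedges T" 
      using e graph_iso_edge_iff[OF f] wf_graph_edgeD[OF assms(3) e] by simp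
    then show ?thesis using assms(1,2) e unfolding equiv_via_def by simp
  qed
  moreover have "h u * k (f u) \<in> {1, -1}" if "u \<in> sverts S" for u
    using assms(1,2) graph_iso_mem[OF f that] that unfolding equiv_via_def by fastforce
  ultimately show ?thesis using graph_iso_comp[OF f equiv_via_iso[OF assms(2)]]
    by (simp add: equiv_via_def)
qed

text \<open>A copy of \<open>S\<close> on the image of \<open>p\<close>, meant for moving to another
  vertex type, in particular to \<open>nat\<close>. The preimage of an edge is cut down to the
  vertices of \<open>S\<close>, because \<open>p\<close> will be injective only there.\<close>

definition push_sgraph :: "('a \<Rightarrow> 'b) \<Rightarrow> 'a sgraph \<Rightarrow> 'b sgraph" where
  "push_sgraph p S = ((p ` sverts S, (image p) ` sedges S), \<lambda>e. sgn S {v \<in> sverts S. p v \<in> e})"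

lemma sverts_push [simp]: "sverts (push_sgraph p S) = p ` sverts S"
  by (simp add: push_sgraph_def ugraph_def gverts_def)

lemma push_sgraph:
  assumes wf: "wf_sgraph S" and inj: "inj_on p (sverts S)"
  shows "wf_sgraph (push_sgraph p S)" "equiv_via p (\<lambda>_. 1) S (push_sgraph p S)"
proof -
  note wfg = wf_sgraph_wf_graph[OF wf]
  have E: "sedges (push_sgraph p S) = (image p) ` sedges S"
    by (simp add: push_sgraph_def ugraph_def gedges_def)
  have pre: "{w \<in> sverts S. p w \<in> {p u, p v}} = {u, v}" if "u \<in> sverts S" "v \<in> sverts S" for u v
    using that inj by (auto dest: inj_onD)
  then have s: "sgn (push_sgraph p S) {p u, p v} = sgn S {u, v}"
    if "u \<in> sverts S" "v \<in> sverts S" for u v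
    using that by (simp add: push_sgraph_def sgn_def)
  have e: "\<exists>u v. e = {p u, p v} \<and> p u \<noteq> p v \<and> u \<in> sverts S \<and> v \<in> sverts S \<and> {u, v} \<in> sedges S"
    if eS: "e \<in> sedges (push_sgraph p S)" for e
  proof -
    obtain e' where e': "e = p ` e'" "e' \<in> sedges S" using eS unfolding E by blast
    obtain u v where "e' = {u, v}" "u \<noteq> v" "u \<in> sverts S" "v \<in> sverts S"
      using wf_graph_edgeE[OF wfg e'(2)] by blast
    then show ?thesis using e' inj by (auto dest: inj_onD)
  qed
  have fin: "finite (sverts S)" using wfg by (simp add: wf_graph_def)
  have "wf_graph (ugraph (push_sgraph p S))"
    unfolding wf_graph_def using fin e by fastforce
  moreover have "sgn (push_sgraph p S) e \<in> {1, -1}" if "e \<in> sedges (push_sgraph p S)" for e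
    using e[OF that] s wf unfolding wf_sgraph_def by fastforce
  ultimately show "wf_sgraph (push_sgraph p S)" by (simp add: wf_sgraph_def)
  have "{u, v} \<in> sedges S \<longleftrightarrow> {p u, p v} \<in> sedges (push_sgraph p S)"
    if uv: "u \<in> sverts S" "v \<in> sverts S" for u v
  proof
    assume "{u, v} \<in> sedges S" then show "{p u, p v} \<in> sedges (push_sgraph p S)"
      using imageI[of "{u, v}" "sedges S" "image p"] E by simp
  next
    assume "{p u, p v} \<in> sedges (push_sgraph p S)"
    then obtain u' v' where "{p u, p v} = {p u', p v'}" "u' \<in> sverts S" "v' \<in> sverts S" "{u', v'} \<in> sedges S"
      using e[of "{p u, p v}"] by auto
    then show "{u, v} \<in> sedges S" using pre[OF uv] pre[of u' v'] by simp
  qed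
  then have "graph_iso p (ugraph S) (ugraph (push_sgraph p S))"
    using inj by (simp add: graph_iso_def bij_betw_def)
  then show "equiv_via p (\<lambda>_. 1) S (push_sgraph p S)"
    using s wf_graph_edgeD[OF wfg] by (simp add: equiv_via_def)
qed

lemma finite_inj_nat: 
  assumes "finite A" obtains p :: "'a \<Rightarrow> nat" where "inj_on p A"
  using assms finite_imp_inj_to_nat_seg by blast

subsection \<open>Products\<close>

lemma prod_step_sym: "prod_step Gs i x y \<Longrightarrow> prod_step Gs i y x"
  by (auto simp: prod_step_def insert_commute)

lemma gverts_gprod [simp]: "gverts (gprod_list Gs) = prod_verts Gs"
  by (simp add: gprod_list_def gverts_def)

lemma gprod_edge_iff: "{x, y} \<in> gedges (gprod_list Gs) \<longleftrightarrow> (\<exists>i. prod_step Gs i x y)"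
  by (auto simp: gprod_list_def gedges_def doubleton_eq_iff intro: prod_step_sym)

lemma ugraph_sprod [simp]: "ugraph (sprod_list Ss) = gprod_list (map ugraph Ss)"
  by (simp add: sprod_list_def ugraph_def)

lemma length_prod_verts: "x \<in> prod_verts Gs \<Longrightarrow> length x = length Gs"
  by (simp add: prod_verts_def)

lemma nth_prod_verts: "\<lbrakk>x \<in> prod_verts Gs; i < length Gs\<rbrakk> \<Longrightarrow> x ! i \<in> gverts (Gs ! i)"
  by (simp add: prod_verts_def)

lemma prod_verts_update:
  "\<lbrakk>x \<in> prod_verts Gs; v \<in> gverts (Gs ! i)\<rbrakk> \<Longrightarrow> x[i := v] \<in> prod_verts Gs"
  by (cases "i < length Gs") (auto simp: prod_verts_def nth_list_update)

lemma prod_verts_eqI: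
  "\<lbrakk>x \<in> prod_verts Gs; y \<in> prod_verts Gs; \<And>i. i < length Gs \<Longrightarrow> x ! i = y ! i\<rbrakk> \<Longrightarrow> x = y"
  by (simp add: prod_verts_def list_eq_iff_nth_eq)

lemma prod_step_nth_neq:
  "\<lbrakk>prod_step Gs i x y; \<forall>G\<in>set Gs. wf_graph G\<rbrakk> \<Longrightarrow> x ! i \<noteq> y ! i"
  using wf_graph_edgeD(1)[of "Gs ! i" "x ! i" "y ! i"] by (simp add: prod_step_def)

text \<open>The choice in \<open>sprod_list\<close> is forced: the ends of an edge of a product of
  loopless graphs differ in exactly one coordinate, which fixes the index, and the value does not
  depend on the order in which the ends are named.\<close>

lemma sgn_sprod:
  assumes "\<forall>S\<in>set Ss. wf_sgraph S" "prod_step (map ugraph Ss) i x y"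
  shows "sgn (sprod_list Ss) {x, y} = sgn (Ss ! i) {x ! i, y ! i}"
proof -
  have wf: "\<forall>G\<in>set (map ugraph Ss). wf_graph G" using assms(1) by (auto simp: wf_sgraph_def)
  have u: "k = i" if "prod_step (map ugraph Ss) k x y" for k
    using that assms(2) prod_step_nth_neq[OF that wf] unfolding prod_step_def by metis
  have "sgn (sprod_list Ss) {x, y} = (SOME s. \<exists>xs ys k. {x, y} = {xs, ys} \<and>
      prod_step (map ugraph Ss) k xs ys \<and> s = sgn (Ss ! k) {xs ! k, ys ! k})"
    by (simp add: sprod_list_def sgn_def)
  also have "\<dots> = sgn (Ss ! i) {x ! i, y ! i}"
  proof (rule some_equality)
    show "\<exists>xs ys k. {x, y} = {xs, ys} \<and> prod_step (map ugraph Ss) k xs ys \<and>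
       sgn (Ss ! i) {x ! i, y ! i} = sgn (Ss ! k) {xs ! k, ys ! k}" using assms(2) by blast
  next
    fix s assume "\<exists>xs ys k. {x, y} = {xs, ys} \<and> prod_step (map ugraph Ss) k xs ys \<and>
       s = sgn (Ss ! k) {xs ! k, ys ! k}"
    then obtain xs ys k where k: "{x, y} = {xs, ys}" "prod_step (map ugraph Ss) k xs ys"
      "s = sgn (Ss ! k) {xs ! k, ys ! k}" by blast
    have "prod_step (map ugraph Ss) k x y" "{xs ! k, ys ! k} = {x ! k, y ! k}"
      using k(1,2) prod_step_sym[OF k(2)] by (auto simp: doubleton_eq_iff)
    then show "s = sgn (Ss ! i) {x ! i, y ! i}" using u k(3) by simp
  qed
  finally show ?thesis .
qed

lemma wf_gprod:
  assumes "\<forall>G\<in>set Gs. wf_graph G"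
  shows "wf_graph (gprod_list Gs)"
proof -
  have "prod_verts Gs \<subseteq> {xs. set xs \<subseteq> (\<Union>G\<in>set Gs. gverts G) \<and> length xs = length Gs}"
    by (fastforce simp: prod_verts_def in_set_conv_nth)
  moreover have "finite (\<Union>G\<in>set Gs. gverts G)" using assms by (auto simp: wf_graph_def)
  ultimately have "finite (prod_verts Gs)" using finite_lists_length_eq finite_subset by blast
  moreover have "\<exists>u v. u \<noteq> v \<and> u \<in> prod_verts Gs \<and> v \<in> prod_verts Gs \<and> e = {u, v}"
    if eG: "e \<in> gedges (gprod_list Gs)" for e
  proof -
    obtain x y k where "e = {x, y}" "prod_step Gs k x y"
      using eG by (auto simp: gprod_list_def gedges_def)
    then show ?thesis using prod_step_nth_neq[OF _ assms, of k x y]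
      by (intro exI[of _ x] exI[of _ y]) (auto simp: prod_step_def)
  qed
  ultimately show ?thesis by (simp add: wf_graph_def)
qed

lemma connected_factor:
  assumes "connected_graph (gprod_list Gs)" "i < length Gs"
  shows "connected_graph (Gs ! i)"
proof -
  obtain a where a: "a \<in> prod_verts Gs" using assms(1) by (auto simp: connected_graph_def)
  \<comment> \<open>The projection of a walk stands still whenever the walk moves in another
    coordinate.\<close>
  have proj: "(x ! i, y ! i) \<in> {(x, y). {x, y} \<in> gedges (Gs ! i)}\<^sup>*"
    if "(x, y) \<in> {(x, y). {x, y} \<in> gedges (gprod_list Gs)}\<^sup>*" for x y
    using that
  proof (induction rule: rtrancl_induct)
    case (step y z)
    then obtain k where "prod_step Gs k y z" by (auto simp: gprod_edge_iff)
    then have "y ! i = z ! i \<or> {y ! i, z ! i} \<in> gedges (Gs ! i)"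
      using assms(2) by (cases "k = i") (auto simp: prod_step_def)
    then show ?case using step.IH by (auto intro: rtrancl_into_rtrancl)
  qed simp
  show ?thesis unfolding connected_graph_def
  proof (intro conjI ballI)
    show "gverts (Gs ! i) \<noteq> {}" using nth_prod_verts[OF a assms(2)] by blast
    fix u v assume "u \<in> gverts (Gs ! i)" "v \<in> gverts (Gs ! i)"
    then have "(a[i := u], a[i := v]) \<in> {(x, y). {x, y} \<in> gedges (gprod_list Gs)}\<^sup>*"
      using assms(1) prod_verts_update[OF a] by (simp add: connected_graph_def)
    from proj[OF this] show "(u, v) \<in> {(x, y). {x, y} \<in> gedges (Gs ! i)}\<^sup>*"
      using length_prod_verts[OF a] assms(2) by simp
  qed
qed

text \<open>The layer through \<open>a\<close> in direction \<open>i\<close> is an induced copy of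
  the factor: its vertices agree in all other coordinates, so no edge of another direction joins two
  of them.\<close>

lemma gprod_edge_update_iff:
  assumes "\<forall>G\<in>set Gs. wf_graph G" "a \<in> prod_verts Gs" "i < length Gs"
    "u \<in> gverts (Gs ! i)" "v \<in> gverts (Gs ! i)"
  shows "{a[i := u], a[i := v]} \<in> gedges (gprod_list Gs) \<longleftrightarrow> {u, v} \<in> gedges (Gs ! i)"
    and "{u, v} \<in> gedges (Gs ! i) \<Longrightarrow> prod_step Gs i (a[i := u]) (a[i := v])"
proof -
  show "{u, v} \<in> gedges (Gs ! i) \<Longrightarrow> prod_step Gs i (a[i := u]) (a[i := v])"
    using assms prod_verts_update[OF assms(2)] length_prod_verts[OF assms(2)] by (simp add: prod_step_def)
  moreover have "{u, v} \<in> gedges (Gs ! i)" if "prod_step Gs k (a[i := u]) (a[i := v])" for k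
    using that prod_step_nth_neq[OF that assms(1)] assms(3) length_prod_verts[OF assms(2)]
    by (cases "k = i") (auto simp: prod_step_def)
  ultimately show "{a[i := u], a[i := v]} \<in> gedges (gprod_list Gs) \<longleftrightarrow> {u, v} \<in> gedges (Gs ! i)"
    unfolding gprod_edge_iff by blast
qed

subsection \<open>Boxes\<close>

text \<open>An exchange condition in place of a product of subsets: it names no subsets, and only
  one coordinate at a time has to be checked. The sets in question are the projections of
  \<open>W\<close>, as \<open>is_box_mem\<close> confirms.\<close>

definition is_box :: "'a graph list \<Rightarrow> 'a list set \<Rightarrow> bool" where
  "is_box Gs W \<longleftrightarrow> W \<subseteq> prod_verts Gs \<and> W \<noteq> {} \<and>
     (\<forall>x\<in>W. \<forall>y\<in>W. \<forall>j<length Gs. x[j := y ! j] \<in> W)"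

lemma is_box_mem:
  assumes "is_box Gs W" "z \<in> prod_verts Gs" "\<And>j. j < length Gs \<Longrightarrow> \<exists>w\<in>W. w ! j = z ! j"
  shows "z \<in> W"
proof -
  have "\<exists>x\<in>W. \<forall>j<m. x ! j = z ! j" if "m \<le> length Gs" for m
    using that
  proof (induction m)
    case 0
    then show ?case using assms(1) by (auto simp: is_box_def)
  next
    case (Suc m)
    then obtain x w where "x \<in> W" "\<forall>j<m. x ! j = z ! j" "w \<in> W" "w ! m = z ! m"
      using assms(3)[of m] by (auto simp: less_eq_Suc_le)
    moreover from this have "length x = length Gs" "x[m := w ! m] \<in> W"
      using assms(1) Suc.prems length_prod_verts[of x Gs] unfolding is_box_def
      by (blast, metis Suc_le_lessD)
    ultimately show ?case using Suc.prems
      by (intro bexI[of _ "x[m := w ! m]"]) (auto simp: nth_list_update less_Suc_eq)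
  qed
  then obtain x where "x \<in> W" "\<forall>j<length Gs. x ! j = z ! j" by blast
  then show ?thesis using assms(1,2) prod_verts_eqI[of x Gs z] unfolding is_box_def by blast
qed

text \<open>A walk from \<open>x\<close> to \<open>y\<close> inside \<open>W\<close> is pushed, one square at a time, into the fibre of
  direction \<open>j\<close> through \<open>x\<close>; closedness supplies the fourth corner of each square.\<close>

lemma is_boxI:
  assumes wf: "\<forall>G\<in>set Gs. wf_graph G" and W: "W \<subseteq> prod_verts Gs" "W \<noteq> {}"
    and closed: "\<And>x y z. \<lbrakk>x \<in> W; y \<in> W; x \<noteq> y; {x, z} \<in> gedges (gprod_list Gs);
        {y, z} \<in> gedges (gprod_list Gs)\<rbrakk> \<Longrightarrow> z \<in> W"
    and conn: "\<And>x y. \<lbrakk>x \<in> W; y \<in> W\<rbrakk> \<Longrightarrow>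
        (x, y) \<in> {(x, y). x \<in> W \<and> y \<in> W \<and> {x, y} \<in> gedges (gprod_list Gs)}\<^sup>*"
  shows "is_box Gs W"
proof -
  have ex: "x[j := y ! j] \<in> W" if xW: "x \<in> W" and yW: "y \<in> W" and j: "j < length Gs" for x y j
  proof -
    let ?R = "{(x, y). x \<in> W \<and> y \<in> W \<and> prod_step Gs j x y}"
    have len: "length x = length Gs" if "x \<in> W" for x using that W length_prod_verts by auto
    have "(x, x[j := y ! j]) \<in> ?R\<^sup>* \<and> x \<in> W" using conn[OF xW yW]
    proof (induction rule: converse_rtrancl_induct)
      case base
      then show ?case using yW by simp
    next
      case (step x x')
      then obtain i where xW: "x \<in> W" and x'W: "x' \<in> W" and i: "prod_step Gs i x x'"
        by (auto simp: gprod_edge_iff)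
      show ?case
      proof (cases "i = j")
        case True
        then have "x[j := y ! j] = x'[j := y ! j]"
          using i len[OF xW] len[OF x'W] by (auto simp: prod_step_def list_eq_iff_nth_eq nth_list_update)
        moreover have "(x, x') \<in> ?R" using xW x'W i True by simp
        ultimately show ?thesis using step.IH xW by (auto intro: converse_rtrancl_into_rtrancl)
      next
        case False
        \<comment> \<open>The fibre through \<open>x'\<close> is copied to the parallel fibre
          through \<open>x\<close>. That \<open>z\<close> agrees with \<open>x'\<close> off
          \<open>j\<close> is carried along because it makes \<open>z\<close> and its copy adjacent
          in direction \<open>i\<close>.\<close>
        have "(x, x[j := z ! j]) \<in> ?R\<^sup>* \<and> x[j := z ! j] \<in> W \<and> z \<in> W \<and> (\<forall>k<length Gs. k \<noteq> j \<longrightarrow> z ! k = x' ! k)"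
          if "(x', z) \<in> ?R\<^sup>*" for z
          using that
        proof (induction rule: rtrancl_induct)
          case base
          have "x ! j = x' ! j" using i j False by (auto simp: prod_step_def)
          then have "x[j := x' ! j] = x" by (metis list_update_id)
          then show ?case using xW x'W by simp
        next
          case (step z z')
          let ?w = "x[j := z ! j]" and ?w' = "x[j := z' ! j]"
          from step have zz: "z \<in> W" "z' \<in> W" "prod_step Gs j z z'" and wW: "?w \<in> W"
            and eq: "\<forall>k<length Gs. k \<noteq> j \<longrightarrow> z ! k = x' ! k" by auto
          have eq': "\<forall>k<length Gs. k \<noteq> j \<longrightarrow> z' ! k = x' ! k" using eq zz(3) by (simp add: prod_step_def)
          have il: "i < length Gs" using i by (simp add: prod_step_def)
          have w'P: "?w' \<in> prod_verts Gs"
            using prod_verts_update[of x Gs "z' ! j" j] xW zz W nth_prod_verts j by blast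
          have s1: "prod_step Gs j ?w ?w'"
            using zz(3) wW w'P W j len[OF xW] by (auto simp: prod_step_def)
          have s2: "prod_step Gs i z' ?w'"
            using i zz(2) w'P W j il eq' False len[OF xW] by (auto simp: prod_step_def nth_list_update insert_commute)
          \<comment> \<open>Closedness speaks of two distinct vertices; these opposite corners of
            the square differ in coordinate \<open>i\<close>.\<close>
          have "?w \<noteq> z'"
            using prod_step_nth_neq[OF i wf] eq' False il len[OF xW] by (metis nth_list_update_neq)
          then have "?w' \<in> W" using closed[of ?w z' ?w'] wW zz s1 s2 gprod_edge_iff by blast
          moreover from this have "(x, ?w') \<in> ?R\<^sup>*" using step.IH s1 wW by (auto intro: rtrancl_into_rtrancl)
          ultimately show ?case using zz eq' by blast
        qed
        from this[of "x'[j := y ! j]"] step.IH show ?thesis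
          using xW j len[OF x'W] by auto
      qed
    qed
    then have "(x, x[j := y ! j]) \<in> ?R\<^sup>*" by blast
    then show ?thesis using xW by (cases rule: rtrancl.cases) auto
  qed
  then show ?thesis using W by (simp add: is_box_def)
qed

lemma layer_image_is_box:
  assumes wfG: "\<forall>G\<in>set Gs. wf_graph G" and wfH: "\<forall>H\<in>set Hs. wf_graph H"
    and f: "graph_iso f (gprod_list Gs) (gprod_list Hs)"
    and a: "a \<in> prod_verts Gs" and i: "i < length Gs" and c: "connected_graph (Gs ! i)"
  shows "is_box Hs ((\<lambda>v. f (a[i := v])) ` gverts (Gs ! i))"
proof (rule is_boxI[OF wfH])
  let ?l = "\<lambda>v. a[i := v]" and ?V = "gverts (Gs ! i)"
  have l: "?l v \<in> prod_verts Gs" if "v \<in> ?V" for v using prod_verts_update[OF a that] .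
  have fl: "f (?l v) \<in> prod_verts Hs" if "v \<in> ?V" for v using graph_iso_mem[OF f] l[OF that] by simp
  have len: "length a = length Gs" using length_prod_verts[OF a] .
  show "(\<lambda>v. f (a[i := v])) ` ?V \<subseteq> prod_verts Hs" using fl by auto
  show "(\<lambda>v. f (a[i := v])) ` ?V \<noteq> {}" using c by (simp add: connected_graph_def)
  show "z \<in> (\<lambda>v. f (a[i := v])) ` ?V"
    if xW: "x \<in> (\<lambda>v. f (a[i := v])) ` ?V" and yW: "y \<in> (\<lambda>v. f (a[i := v])) ` ?V" and ne: "x \<noteq> y"
      and xz: "{x, z} \<in> gedges (gprod_list Hs)" and yz: "{y, z} \<in> gedges (gprod_list Hs)" for x y z
  proof -
    obtain u v where u: "u \<in> ?V" "x = f (?l u)" and v: "v \<in> ?V" "y = f (?l v)" using xW yW by blast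
    have "z \<in> prod_verts Hs" using wf_graph_edgeD(3)[OF wf_gprod[OF wfH] xz] by simp
    then obtain w where w: "w \<in> prod_verts Gs" "z = f w"
      using f unfolding graph_iso_def bij_betw_def gverts_gprod by blast
    have "{?l u, w} \<in> gedges (gprod_list Gs)" "{?l v, w} \<in> gedges (gprod_list Gs)"
      using xz yz u v w l graph_iso_edge_iff[OF f] by auto
    then obtain k m where k: "prod_step Gs k (?l u) w" and m: "prod_step Gs m (?l v) w"
      unfolding gprod_edge_iff by blast
    \<comment> \<open>If the step from \<open>?l u\<close> to \<open>w\<close> changed some
      \<open>k \<noteq> i\<close>, then \<open>w\<close> would keep the entry \<open>u\<close> at
      \<open>i\<close>. As \<open>u \<noteq> v\<close>, the step from \<open>?l v\<close> would have
      to change \<open>i\<close>, and so would leave the entry of \<open>a\<close> at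
      \<open>k\<close>, contradicting the first step.\<close>
    have "k = i"
    proof (rule ccontr)
      assume ki: "k \<noteq> i"
      then have wi: "w ! i = u" using k i len by (auto simp: prod_step_def)
      have "m = i" 
      proof (rule ccontr)
        assume "m \<noteq> i"
        then have "w ! i = v" using m i len by (auto simp: prod_step_def)
        then show False using wi ne u v by simp
      qed
      then have "w ! k = a ! k" using m ki k len by (auto simp: prod_step_def)
      then show False using prod_step_nth_neq[OF k wfG] ki by simp
    qed
    then have "w = ?l (w ! i)"
      using k len length_prod_verts[OF w(1)] by (auto simp: prod_step_def list_eq_iff_nth_eq nth_list_update)
    then show ?thesis using w nth_prod_verts[OF w(1) i] by (intro image_eqI[of _ _ "w ! i"]) auto
  qed
  let ?W = "(\<lambda>v. f (a[i := v])) ` ?V"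
  show "(x, y) \<in> {(x, y). x \<in> ?W \<and> y \<in> ?W \<and> {x, y} \<in> gedges (gprod_list Hs)}\<^sup>*"
    if "x \<in> ?W" "y \<in> ?W" for x y
  proof -
    obtain u v where u: "u \<in> ?V" "x = f (?l u)" and v: "v \<in> ?V" "y = f (?l v)" using \<open>x \<in> ?W\<close> \<open>y \<in> ?W\<close> by blast
    have wfi: "wf_graph (Gs ! i)" using wfG i by simp
    have "(u, v) \<in> {(x, y). {x, y} \<in> gedges (Gs ! i)}\<^sup>*" using c u v by (simp add: connected_graph_def)
    then have "(f (?l u), f (?l v)) \<in> {(x, y). x \<in> ?W \<and> y \<in> ?W \<and> {x, y} \<in> gedges (gprod_list Hs)}\<^sup>*"
    proof (induction rule: rtrancl_induct)
      case (step s t)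
      then have e: "{s, t} \<in> gedges (Gs ! i)" by simp
      note st = wf_graph_edgeD[OF wfi e]
      have "{f (?l s), f (?l t)} \<in> gedges (gprod_list Hs)"
        using graph_iso_edge_iff[OF f] l st gprod_edge_update_iff(1)[OF wfG a i st(2,3)] e by simp
      then show ?case using step.IH st by (auto intro: rtrancl_into_rtrancl)
    qed simp
    then show ?thesis using u v by simp
  qed
qed

subsection \<open>Two coordinates make a signed graph composite\<close>

text \<open>One fibre of \<open>q\<close>, the one through \<open>x\<close>, serves as the factor,
  with its signature already switched by \<open>h\<close>. By \<open>surj\<close> every value of
  \<open>p\<close> occurs on it, by \<open>inj\<close> the map \<open>p\<close> is injective there,
  and \<open>transport\<close> says that edges and switched signs are the same on all fibres, so the
  chosen one stands for all.\<close>

lemma coordinate_factor: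
  fixes T :: "'a sgraph" and p :: "'a \<Rightarrow> 'c" and q :: "'a \<Rightarrow> 'd" and s :: "'a \<Rightarrow> 'a \<Rightarrow> int"
  assumes wf: "wf_sgraph T" and h: "\<And>u. u \<in> sverts T \<Longrightarrow> h u \<in> {1, -1}"
    and s: "\<And>u v. {u, v} \<in> sedges T \<Longrightarrow> s u v = h u * h v * sgn T {u, v}"
    and inj: "\<And>u v. \<lbrakk>u \<in> sverts T; v \<in> sverts T; p u = p v; q u = q v\<rbrakk> \<Longrightarrow> u = v"
    and surj: "\<And>u v. \<lbrakk>u \<in> sverts T; v \<in> sverts T\<rbrakk> \<Longrightarrow> \<exists>w\<in>sverts T. p w = p u \<and> q w = q v"
    and transport: "\<And>u v u' v'. \<lbrakk>{u, v} \<in> sedges T; q u = q v; u' \<in> sverts T; v' \<in> sverts T;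
      q u' = q v'; p u' = p u; p v' = p v\<rbrakk> \<Longrightarrow> {u', v'} \<in> sedges T \<and> s u' v' = s u v"
    and x: "x \<in> sverts T"
  shows "\<exists>A :: 'c sgraph. wf_sgraph A \<and> sverts A = p ` sverts T \<and>
    (\<forall>u\<in>sverts T. \<forall>v\<in>sverts T. q u = q v \<longrightarrow>
      ({p u, p v} \<in> sedges A \<longleftrightarrow> {u, v} \<in> sedges T) \<and>
      ({u, v} \<in> sedges T \<longrightarrow> sgn A {p u, p v} = s u v))"
proof -
  note wfg = wf_sgraph_wf_graph[OF wf]
  define L where "L = {u \<in> sverts T. q u = q x}"
  \<comment> \<open>The product over \<open>e\<close> expresses \<open>h u * h v\<close> as a
    function of the edge as a set, so that \<open>R\<close> carries the sign
    \<open>s u v\<close>.\<close>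
  define R :: "'a sgraph" where "R = ((L, {e \<in> sedges T. e \<subseteq> L}), \<lambda>e. (\<Prod>w\<in>e. h w) * sgn T e)"
  have R: "sverts R = L" "sedges R = {e \<in> sedges T. e \<subseteq> L}" "sgn R e = (\<Prod>w\<in>e. h w) * sgn T e" for e
    by (simp_all add: R_def ugraph_def gverts_def gedges_def sgn_def)
  have sR: "sgn R {u, v} = s u v" if "{u, v} \<in> sedges T" for u v
    using s[OF that] wf_graph_edgeD[OF wfg that] R(3) by simp
  have wfR: "wf_sgraph R"
    unfolding wf_sgraph_def wf_graph_def
  proof (intro conjI ballI)
    show "finite (sverts R)" using wfg by (simp add: R L_def wf_graph_def)
    fix e assume "e \<in> sedges R"
    then have e: "e \<in> sedges T" "e \<subseteq> L" by (auto simp: R)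
    obtain u v where uv: "e = {u, v}" "u \<noteq> v" "u \<in> sverts T" "v \<in> sverts T"
      using wf_graph_edgeE[OF wfg e(1)] by blast
    then show "\<exists>u v. u \<noteq> v \<and> u \<in> sverts R \<and> v \<in> sverts R \<and> e = {u, v}" using e by (auto simp: R)
    have "sgn T e \<in> {1, -1}" using wf e by (simp add: wf_sgraph_def)
    then show "sgn R e \<in> {1, -1}" using h[of u] h[of v] uv by (auto simp: R)
  qed
  have injL: "inj_on p (sverts R)" using inj by (auto simp: R L_def inj_on_def)
  define A where "A = push_sgraph p R"
  note via = push_sgraph(2)[OF wfR injL, folded A_def]
  note iso = equiv_via_iso[OF via]
  have rep: "\<exists>u'\<in>L. p u' = p u" if "u \<in> sverts T" for u
    using surj[OF that x] by (auto simp: L_def)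
  have vA: "sverts A = p ` sverts T"
    using rep by (auto simp: A_def R L_def image_iff) metis
  have both: "({p u, p v} \<in> sedges A \<longleftrightarrow> {u, v} \<in> sedges T) \<and> ({u, v} \<in> sedges T \<longrightarrow> sgn A {p u, p v} = s u v)"
    if uv: "u \<in> sverts T" "v \<in> sverts T" "q u = q v" for u v
  proof -
    obtain u' v' where u': "u' \<in> L" "p u' = p u" and v': "v' \<in> L" "p v' = p v"
      using rep uv by blast
    have inT: "u' \<in> sverts T" "v' \<in> sverts T" "q u' = q v'" using u' v' by (auto simp: L_def)
    have e: "{u', v'} \<in> sedges R \<longleftrightarrow> {u', v'} \<in> sedges T" using u' v' by (simp add: R)
    have a: "{p u', p v'} \<in> sedges A \<longleftrightarrow> {u', v'} \<in> sedges R"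
      using graph_iso_edge_iff[OF iso, of u' v'] u'(1) v'(1) by (simp add: R)
    have b: "{u', v'} \<in> sedges T \<longleftrightarrow> {u, v} \<in> sedges T"
      using transport[of u' v' u v] transport[of u v u' v'] uv inT u' v' by metis
    have "sgn A {p u', p v'} = s u v" if uvT: "{u, v} \<in> sedges T"
    proof -
      have "{u', v'} \<in> sedges R" using uvT b e by simp
      then have "sgn R {u', v'} = sgn A {p u', p v'}" using via by (simp add: equiv_via_def)
      then show ?thesis using sR[of u' v'] b uvT transport[of u v u' v'] uv inT u' v' by simp
    qed
    then show ?thesis using a b e u' v' by simp
  qed
  show ?thesis
    using push_sgraph(1)[OF wfR injL, folded A_def] vA both by (intro exI[of _ A]) simp
qed

lemma prod_step_pair:
  "prod_step [G, H] i [a, b] [a', b'] \<longleftrightarrow>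
     a \<in> gverts G \<and> a' \<in> gverts G \<and> b \<in> gverts H \<and> b' \<in> gverts H \<and>
     (i = 0 \<and> {a, a'} \<in> gedges G \<and> b = b' \<or> i = 1 \<and> {b, b'} \<in> gedges H \<and> a = a')"
proof -
  consider "i = 0" | "i = 1" | "i \<ge> 2" by linarith
  then show ?thesis by cases (auto simp: prod_step_def prod_verts_def All_less_Suc)
qed

lemma prod_verts_pair: "prod_verts [G, H] = {[a, b] | a b. a \<in> gverts G \<and> b \<in> gverts H}"
  by (auto simp: prod_verts_def All_less_Suc length_Suc_conv)

lemma card_image_ge_2:
  assumes "finite V" "u \<in> V" "v \<in> V" "f u \<noteq> f v"
  shows "card (f ` V) \<ge> 2"
  using card_mono[of "f ` V" "{f u, f v}"] assms by simp

text \<open>A criterion for splitting that avoids constructing the factors: \<open>p\<close> and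
  \<open>q\<close> play the two coordinates, and \<open>s\<close> is the sign after a switching,
  required to depend only on the values of the coordinate along which the edge moves. The factors
  come from \<open>coordinate_factor\<close>, used twice with the roles of \<open>p\<close> and
  \<open>q\<close> exchanged; the last two groups of assumptions make both of them
  nontrivial.\<close>

lemma not_s_primeI:
  fixes T :: "'a sgraph" and p :: "'a \<Rightarrow> 'c" and q :: "'a \<Rightarrow> 'd" and s :: "'a \<Rightarrow> 'a \<Rightarrow> int"
  assumes wf: "wf_sgraph T" and h: "\<And>u. u \<in> sverts T \<Longrightarrow> h u \<in> {1, -1}"
    and s: "\<And>u v. {u, v} \<in> sedges T \<Longrightarrow> s u v = h u * h v * sgn T {u, v}"
    and inj: "\<And>u v. \<lbrakk>u \<in> sverts T; v \<in> sverts T; p u = p v; q u = q v\<rbrakk> \<Longrightarrow> u = v"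
    and surj: "\<And>u v. \<lbrakk>u \<in> sverts T; v \<in> sverts T\<rbrakk> \<Longrightarrow> \<exists>w\<in>sverts T. p w = p u \<and> q w = q v"
    and edge: "\<And>u v. {u, v} \<in> sedges T \<Longrightarrow> p u = p v \<or> q u = q v"
    and transport_p: "\<And>u v u' v'. \<lbrakk>{u, v} \<in> sedges T; q u = q v; u' \<in> sverts T; v' \<in> sverts T;
      q u' = q v'; p u' = p u; p v' = p v\<rbrakk> \<Longrightarrow> {u', v'} \<in> sedges T \<and> s u' v' = s u v"
    and transport_q: "\<And>u v u' v'. \<lbrakk>{u, v} \<in> sedges T; p u = p v; u' \<in> sverts T; v' \<in> sverts T;
      p u' = p v'; q u' = q u; q v' = q v\<rbrakk> \<Longrightarrow> {u', v'} \<in> sedges T \<and> s u' v' = s u v"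
    and np: "u1 \<in> sverts T" "v1 \<in> sverts T" "p u1 \<noteq> p v1"
    and nq: "u2 \<in> sverts T" "v2 \<in> sverts T" "q u2 \<noteq> q v2"
  shows "\<not> s_prime T"
proof -
  note wfg = wf_sgraph_wf_graph[OF wf]
  have fin: "finite (sverts T)" using wfg by (simp add: wf_graph_def)
  \<comment> \<open>Primality tests only factors on \<open>nat\<close>, so the values of both
    coordinates are encoded there before the factors are formed.\<close>
  obtain P :: "'c \<Rightarrow> nat" where P: "inj_on P (p ` sverts T)" using fin finite_inj_nat by blast
  obtain Q :: "'d \<Rightarrow> nat" where Q: "inj_on Q (q ` sverts T)" using fin finite_inj_nat by blast
  define p' where "p' = P \<circ> p"
  define q' where "q' = Q \<circ> q"
  have p': "p' u = p' v \<longleftrightarrow> p u = p v" if "u \<in> sverts T" "v \<in> sverts T" for u v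
    using that P by (auto simp: p'_def dest: inj_onD)
  have q': "q' u = q' v \<longleftrightarrow> q u = q v" if "u \<in> sverts T" "v \<in> sverts T" for u v
    using that Q by (auto simp: q'_def dest: inj_onD)
  note ed = wf_graph_edgeD[OF wfg]
  have injA: "u = v" if "u \<in> sverts T" "v \<in> sverts T" "p' u = p' v" "q u = q v" for u v
    using inj[OF that(1,2)] that(3,4) p'[OF that(1,2)] by simp
  have surjA: "\<exists>w\<in>sverts T. p' w = p' u \<and> q w = q v" if uv: "u \<in> sverts T" "v \<in> sverts T" for u v
    using surj[OF uv] by (elim bexE, intro bexI) (simp_all add: p'_def)
  have trA: "{u', v'} \<in> sedges T \<and> s u' v' = s u v"
    if e: "{u, v} \<in> sedges T" "q u = q v" "u' \<in> sverts T" "v' \<in> sverts T" "q u' = q v'"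
      and e': "p' u' = p' u" "p' v' = p' v" for u v u' v'
  proof -
    have "p u' = p u" "p v' = p v" using e' p' e(3,4) ed(2,3)[OF e(1)] by blast+
    then show ?thesis by (rule transport_p[OF e])
  qed
  have "\<exists>A :: nat sgraph. wf_sgraph A \<and> sverts A = p' ` sverts T \<and>
    (\<forall>u\<in>sverts T. \<forall>v\<in>sverts T. q u = q v \<longrightarrow>
      ({p' u, p' v} \<in> sedges A \<longleftrightarrow> {u, v} \<in> sedges T) \<and>
      ({u, v} \<in> sedges T \<longrightarrow> sgn A {p' u, p' v} = s u v))"
    by (rule coordinate_factor[where h = h]) (fact wf h s injA surjA trA np(1))+
  then obtain A where A: "wf_sgraph A" "sverts A = p' ` sverts T"
    "\<forall>u\<in>sverts T. \<forall>v\<in>sverts T. q u = q v \<longrightarrow>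
      ({p' u, p' v} \<in> sedges A \<longleftrightarrow> {u, v} \<in> sedges T) \<and>
      ({u, v} \<in> sedges T \<longrightarrow> sgn A {p' u, p' v} = s u v)"
    by (elim exE conjE) (rule that)
  have injB: "u = v" if "u \<in> sverts T" "v \<in> sverts T" "q' u = q' v" "p u = p v" for u v
    using inj[OF that(1,2)] that(3,4) q'[OF that(1,2)] by simp
  have surjB: "\<exists>w\<in>sverts T. q' w = q' u \<and> p w = p v" if uv: "u \<in> sverts T" "v \<in> sverts T" for u v
    using surj[OF uv(2,1)] by (elim bexE, intro bexI) (simp_all add: q'_def)
  have trB: "{u', v'} \<in> sedges T \<and> s u' v' = s u v"
    if e: "{u, v} \<in> sedges T" "p u = p v" "u' \<in> sverts T" "v' \<in> sverts T" "p u' = p v'"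
      and e': "q' u' = q' u" "q' v' = q' v" for u v u' v'
  proof -
    have "q u' = q u" "q v' = q v" using e' q' e(3,4) ed(2,3)[OF e(1)] by blast+
    then show ?thesis by (rule transport_q[OF e])
  qed
  have "\<exists>B :: nat sgraph. wf_sgraph B \<and> sverts B = q' ` sverts T \<and>
    (\<forall>u\<in>sverts T. \<forall>v\<in>sverts T. p u = p v \<longrightarrow>
      ({q' u, q' v} \<in> sedges B \<longleftrightarrow> {u, v} \<in> sedges T) \<and>
      ({u, v} \<in> sedges T \<longrightarrow> sgn B {q' u, q' v} = s u v))"
    by (rule coordinate_factor[where h = h]) (fact wf h s injB surjB trB np(1))+
  then obtain B where B: "wf_sgraph B" "sverts B = q' ` sverts T"
    "\<forall>u\<in>sverts T. \<forall>v\<in>sverts T. p u = p v \<longrightarrow>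
      ({q' u, q' v} \<in> sedges B \<longleftrightarrow> {u, v} \<in> sedges T) \<and>
      ({u, v} \<in> sedges T \<longrightarrow> sgn B {q' u, q' v} = s u v)"
    by (elim exE conjE) (rule that)
  define F where "F = (\<lambda>v. [p' v, q' v])"
  have wfAB: "\<forall>S\<in>set [A, B]. wf_sgraph S" using A(1) B(1) by simp
  have step: "prod_step (map ugraph [A, B]) i (F u) (F v) \<longleftrightarrow>
      {u, v} \<in> sedges T \<and> (i = 0 \<and> q u = q v \<or> i = 1 \<and> p u = p v)"
    if "u \<in> sverts T" "v \<in> sverts T" for i u v
    using that A(2,3) B(2,3) p' q' by (auto simp: F_def prod_step_pair)
  have "inj_on F (sverts T)" using inj p' q' by (auto simp: F_def inj_on_def)
  moreover have "F ` sverts T = prod_verts (map ugraph [A, B])"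
  proof (intro equalityI subsetI)
    fix z assume "z \<in> prod_verts (map ugraph [A, B])"
    then obtain u v where uv: "u \<in> sverts T" "v \<in> sverts T" "z = [p' u, q' v]"
      using A(2) B(2) by (auto simp: prod_verts_pair)
    then obtain w where "w \<in> sverts T" "p w = p u" "q w = q v" using surj by blast
    then show "z \<in> F ` sverts T"
      using uv by (intro image_eqI[of _ _ w]) (simp_all add: F_def p'_def q'_def)
  qed (auto simp: F_def prod_verts_pair A(2) B(2))
  moreover have "{u, v} \<in> sedges T \<longleftrightarrow> (\<exists>i. prod_step (map ugraph [A, B]) i (F u) (F v))"
    if "u \<in> sverts T" "v \<in> sverts T" for u v
    using step[OF that] edge[of u v] by auto
  ultimately have iso: "graph_iso F (ugraph T) (ugraph (sprod_list [A, B]))"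
    unfolding graph_iso_def bij_betw_def ugraph_sprod gverts_gprod gprod_edge_iff by simp
  have "sgn T {u, v} = h u * h v * sgn (sprod_list [A, B]) {F u, F v}" if e: "{u, v} \<in> sedges T" for u v
  proof -
    note uv = ed[OF e]
    have "sgn (sprod_list [A, B]) {F u, F v} = s u v"
    proof (cases "q u = q v")
      case True
      then have "prod_step (map ugraph [A, B]) 0 (F u) (F v)" using step uv e by simp
      from sgn_sprod[OF wfAB this] show ?thesis using A(3) uv e True by (simp add: F_def)
    next
      case False
      then have p: "p u = p v" using edge[OF e] by simp
      then have "prod_step (map ugraph [A, B]) 1 (F u) (F v)" using step uv e by simp
      from sgn_sprod[OF wfAB this] p show ?thesis using B(3) uv e by (simp add: F_def)
    qed
    then show ?thesis using s[OF e] h[of u] h[of v] uv by auto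
  qed
  then have "equiv_via F h T (sprod_list [A, B])" using iso h by (simp add: equiv_via_def)
  then have "s_equiv T (sprod_list [A, B])" using s_equiv_iff_equiv_via[OF wf] by blast
  moreover have "card (sverts A) \<ge> 2" "card (sverts B) \<ge> 2"
    using A(2) B(2) card_image_ge_2[OF fin np(1,2), of p'] card_image_ge_2[OF fin nq(1,2), of q']
      p'[OF np(1,2)] q'[OF nq(1,2)] np nq by simp_all
  ultimately show ?thesis unfolding s_prime_def using A(1) B(1) by blast
qed

subsection \<open>Layers of prime factors\<close>

text \<open>If the image of the layer, a box, were nonconstant in two coordinates, then one of them and
  the tuple of the remaining ones would split the \<open>s\<close>-prime factor.\<close>

lemma s_prime_layer_image:
  assumes wfS: "\<forall>S\<in>set Ss. wf_sgraph S" and wfT: "\<forall>T\<in>set Ts. wf_sgraph T"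
    and via: "equiv_via f h (sprod_list Ss) (sprod_list Ts)"
    and a: "a \<in> prod_verts (map ugraph Ss)" and i: "i < length Ss"
    and c: "connected_graph (ugraph (Ss ! i))" and prime: "s_prime (Ss ! i)" and "Ts \<noteq> []"
  shows "\<exists>j<length Ts. \<forall>v\<in>sverts (Ss ! i). \<forall>k<length Ts. k \<noteq> j \<longrightarrow> f (a[i := v]) ! k = f a ! k"
proof (rule ccontr)
  define F where "F = (\<lambda>v. f (a[i := v]))"
  let ?V = "sverts (Ss ! i)" and ?Gs = "map ugraph Ss" and ?Hs = "map ugraph Ts"
  assume "\<not> ?thesis"
  \<comment> \<open>Used twice: an arbitrary index, namely 0, yields one coordinate \<open>j\<close>
    in which the image moves, and then \<open>j\<close> itself yields a second one.\<close>
  then have split: "\<exists>v\<in>?V. \<exists>k<length Ts. k \<noteq> j \<and> F v ! k \<noteq> f a ! k" if "j < length Ts" for j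
    using that by (auto simp: F_def)
  obtain v1 j where v1: "v1 \<in> ?V" "j < length Ts" "F v1 ! j \<noteq> f a ! j"
    using split[of 0] \<open>Ts \<noteq> []\<close> by auto
  obtain v2 k2 where v2: "v2 \<in> ?V" "k2 < length Ts" "k2 \<noteq> j" "F v2 ! k2 \<noteq> f a ! k2"
    using split[OF v1(2)] by auto
  have wfG: "\<forall>G\<in>set ?Gs. wf_graph G" and wfH: "\<forall>G\<in>set ?Hs. wf_graph G"
    using wfS wfT by (auto simp: wf_sgraph_def)
  note f = equiv_via_iso[OF via, unfolded ugraph_sprod]
  have i': "i < length ?Gs" using i by simp
  have box: "is_box ?Hs (F ` ?V)"
    using layer_image_is_box[OF wfG wfH f a i'] c i by (simp add: F_def)
  have aV: "a ! i \<in> ?V" using nth_prod_verts[OF a] i by simp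
  have Fa: "F (a ! i) = f a" by (simp add: F_def)
  have up: "a[i := v] \<in> prod_verts ?Gs" if "v \<in> ?V" for v using prod_verts_update[OF a] that i by simp
  have len: "length (F v) = length Ts" if "v \<in> ?V" for v
    using graph_iso_mem[OF f] up[OF that] length_prod_verts[of "F v" ?Hs] by (simp add: F_def)
  have la: "length a = length Ss" using length_prod_verts[OF a] by simp
  have Finj: "u = v" if "F u = F v" "u \<in> ?V" "v \<in> ?V" for u v
  proof -
    have "a[i := u] = a[i := v]"
      using that up graph_iso_inj[OF f] unfolding F_def by (auto dest: inj_onD)
    then show ?thesis using la i by (metis nth_list_update_eq)
  qed
  have Fedge: "{u, v} \<in> sedges (Ss ! i) \<longleftrightarrow> (\<exists>k. prod_step ?Hs k (F u) (F v))"
    if "u \<in> ?V" "v \<in> ?V" for u v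
    using gprod_edge_update_iff(1)[OF wfG a i', of u v] graph_iso_edge_iff[OF f, of "a[i := u]" "a[i := v]"]
      that up i by (simp add: F_def gprod_edge_iff)
  have wfi: "wf_sgraph (Ss ! i)" using wfS i by simp
  note ed = wf_graph_edgeD[OF wf_sgraph_wf_graph[OF wfi]]
  have FP: "F v \<in> prod_verts ?Hs" if "v \<in> ?V" for v
    using graph_iso_mem[OF f] up[OF that] by (simp add: F_def)
  have h: "h (a[i := v]) \<in> {1, -1}" if "v \<in> ?V" for v
    using via up[OF that] by (simp add: equiv_via_def)
  have "\<not> s_prime (Ss ! i)"
  \<comment> \<open>Overwriting the entry at \<open>j\<close> by the constant \<open>f a ! j\<close>
    keeps exactly the tuple of the remaining coordinates. The signs \<open>s\<close> are those of
    the target product.\<close>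
  proof (rule not_s_primeI[where T = "Ss ! i" and h = "\<lambda>v. h (a[i := v])" and p = "\<lambda>v. F v ! j" and q = "\<lambda>v. (F v)[j := f a ! j]"
      and s = "\<lambda>u v. sgn (sprod_list Ts) {F u, F v}"])
    fix u v assume e: "{u, v} \<in> sedges (Ss ! i)"
    note uv = ed[OF e]
    have st: "prod_step ?Gs i (a[i := u]) (a[i := v])" using gprod_edge_update_iff(2)[OF wfG a i'] uv e i by simp
    then have "{a[i := u], a[i := v]} \<in> sedges (sprod_list Ss)" by (auto simp: gprod_edge_iff)
    then have "sgn (sprod_list Ss) {a[i := u], a[i := v]} = h (a[i := u]) * h (a[i := v]) * sgn (sprod_list Ts) {F u, F v}"
      using via by (simp add: equiv_via_def F_def)
    moreover have "sgn (sprod_list Ss) {a[i := u], a[i := v]} = sgn (Ss ! i) {u, v}"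
      using sgn_sprod[OF wfS st] la i by simp
    ultimately show "sgn (sprod_list Ts) {F u, F v} = h (a[i := u]) * h (a[i := v]) * sgn (Ss ! i) {u, v}"
      using h[of u] h[of v] uv by auto
    obtain k where k: "prod_step ?Hs k (F u) (F v)" using Fedge e uv by blast
    show "F u ! j = F v ! j \<or> (F u)[j := f a ! j] = (F v)[j := f a ! j]"
    proof (cases "k = j")
      case True
      then have "(F u)[j := f a ! j] = (F v)[j := f a ! j]"
        using k len uv by (auto simp: prod_step_def list_eq_iff_nth_eq nth_list_update)
      then show ?thesis ..
    qed (use k v1(2) in \<open>simp add: prod_step_def\<close>)
  next
    fix u v assume uv: "u \<in> ?V" "v \<in> ?V"
    show "u = v" if "F u ! j = F v ! j" "(F u)[j := f a ! j] = (F v)[j := f a ! j]"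
      using Finj[OF _ uv] that len uv by (metis list_update_id list_update_overwrite)
    \<comment> \<open>The box property is what gives surjectivity: the entry of \<open>F u\<close>
      at \<open>j\<close> and the remaining entries of \<open>F v\<close> occur together.\<close>
    have "(F v)[j := F u ! j] \<in> F ` ?V" using box uv v1(2) by (simp add: is_box_def)
    then obtain w where w: "w \<in> ?V" "F w = (F v)[j := F u ! j]" by (metis imageE)
    show "\<exists>w\<in>?V. F w ! j = F u ! j \<and> (F w)[j := f a ! j] = (F v)[j := f a ! j]"
      using w len uv v1(2) by (intro bexI[of _ w]) auto
  next
    fix u v u' v'
    assume e: "{u, v} \<in> sedges (Ss ! i)" and q: "(F u)[j := f a ! j] = (F v)[j := f a ! j]"
      and V: "u' \<in> ?V" "v' \<in> ?V" and q': "(F u')[j := f a ! j] = (F v')[j := f a ! j]"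
      and p: "F u' ! j = F u ! j" "F v' ! j = F v ! j"
    note uv = ed[OF e]
    obtain k where k: "prod_step ?Hs k (F u) (F v)" using Fedge e uv by blast
    \<comment> \<open>A step in any other direction would change the tuple of the remaining
      coordinates.\<close>
    have kj: "k = j" using prod_step_nth_neq[OF k wfH] q by (metis nth_list_update_neq)
    have st: "prod_step ?Hs j (F u) (F v)" using k kj by simp
    have oth: "F u' ! m = F v' ! m" if "m \<noteq> j" for m using q' that by (metis nth_list_update_neq)
    have st': "prod_step ?Hs j (F u') (F v')"
      using st FP[OF V(1)] FP[OF V(2)] p oth by (auto simp: prod_step_def)
    show "{u', v'} \<in> sedges (Ss ! i) \<and> sgn (sprod_list Ts) {F u', F v'} = sgn (sprod_list Ts) {F u, F v}"
      using Fedge[OF V] st' sgn_sprod[OF wfT st] sgn_sprod[OF wfT st'] p by auto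
  next
    fix u v u' v'
    assume e: "{u, v} \<in> sedges (Ss ! i)" and p: "F u ! j = F v ! j"
      and V: "u' \<in> ?V" "v' \<in> ?V" and p': "F u' ! j = F v' ! j"
      and q: "(F u')[j := f a ! j] = (F u)[j := f a ! j]" "(F v')[j := f a ! j] = (F v)[j := f a ! j]"
    note uv = ed[OF e]
    obtain k where st: "prod_step ?Hs k (F u) (F v)" using Fedge e uv by blast
    have kj: "k \<noteq> j" using prod_step_nth_neq[OF st wfH] p by metis
    have oth: "F u' ! m = F u ! m" "F v' ! m = F v ! m" if "m \<noteq> j" for m
      using q that by (metis nth_list_update_neq)+
    \<comment> \<open>At \<open>m = j\<close> the equality is the assumption on \<open>p\<close>;
      elsewhere the entries are those of \<open>F u\<close> and \<open>F v\<close>, which differ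
      only at \<open>k\<close>.\<close>
    have "F u' ! m = F v' ! m" if "m < length Ts" "m \<noteq> k" for m
      using st that oth[of m] p' by (cases "m = j") (auto simp: prod_step_def)
    then have st': "prod_step ?Hs k (F u') (F v')"
      using st FP[OF V(1)] FP[OF V(2)] oth[OF kj] by (auto simp: prod_step_def)
    show "{u', v'} \<in> sedges (Ss ! i) \<and> sgn (sprod_list Ts) {F u', F v'} = sgn (sprod_list Ts) {F u, F v}"
      using Fedge[OF V] st' sgn_sprod[OF wfT st] sgn_sprod[OF wfT st'] oth[OF kj] by auto
  next
    show "F v1 ! j \<noteq> F (a ! i) ! j" using v1 Fa by simp
    show "(F v2)[j := f a ! j] \<noteq> (F (a ! i))[j := f a ! j]"
      using v2 Fa by (metis nth_list_update_neq)
  qed (use wfi h v1 v2 aV in auto)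
  then show False using prime by simp
qed

section \<open>Matching the factors of two prime decompositions\<close>

lemma layer_image_update:
  assumes f: "graph_iso f (gprod_list Gs) (gprod_list Hs)" and a: "a \<in> prod_verts Gs"
    and v: "v \<in> gverts (Gs ! i)" and j: "j < length Hs"
    and eq: "\<forall>k<length Hs. k \<noteq> j \<longrightarrow> f (a[i := v]) ! k = f a ! k"
  shows "f (a[i := v]) = (f a)[j := f (a[i := v]) ! j]"
    and "f (a[i := v]) ! j \<in> gverts (Hs ! j)"
proof -
  have 1: "f a \<in> prod_verts Hs" "f (a[i := v]) \<in> prod_verts Hs"
    using graph_iso_mem[OF f] a prod_verts_update[OF a v] by auto
  show 2: "f (a[i := v]) ! j \<in> gverts (Hs ! j)" using nth_prod_verts[OF 1(2) j] .
  show "f (a[i := v]) = (f a)[j := f (a[i := v]) ! j]"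
  proof (rule nth_equalityI)
    fix k assume "k < length (f (a[i := v]))"
    then show "f (a[i := v]) ! k = (f a)[j := f (a[i := v]) ! j] ! k"
      using eq length_prod_verts[OF 1(1)] length_prod_verts[OF 1(2)] by (cases "k = j") simp_all
  qed (simp add: length_prod_verts[OF 1(1)] length_prod_verts[OF 1(2)])
qed

lemma edge_other_vertex:
  assumes "wf_graph G" "gedges G \<noteq> {}"
  obtains v where "v \<in> gverts G" "v \<noteq> x"
proof -
  obtain e where "e \<in> gedges G" using assms(2) by blast
  from wf_graph_edgeE[OF assms(1) this] obtain u v where "u \<noteq> v" "u \<in> gverts G" "v \<in> gverts G" .
  then show thesis using that by metis
qed

text \<open>Layers of \<open>Ss\<close> through \<open>a\<close> are sent into layers of
  \<open>Ts\<close> through \<open>b = f a\<close>, giving \<open>\<pi>\<close>, and the inverse map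
  gives \<open>\<rho>\<close>. Distinct layers through one vertex share only that vertex, so the two
  index maps are mutually inverse. The isomorphism between matching layers is then an equivalence of
  the factors, switched by \<open>h\<close> along the layer.\<close>

lemma s_prime_factors_unique:
  assumes wfS: "\<forall>S\<in>set Ss. wf_sgraph S \<and> sedges S \<noteq> {}" and wfT: "\<forall>T\<in>set Ts. wf_sgraph T \<and> sedges T \<noteq> {}"
    and ne: "Ss \<noteq> []" "Ts \<noteq> []"
    and primes: "\<forall>S\<in>set Ss. s_prime S" "\<forall>T\<in>set Ts. s_prime T"
    and via: "equiv_via f h (sprod_list Ss) (sprod_list Ts)"
    and conn: "connected_graph (ugraph (sprod_list Ss))"
  shows "rel_mset s_equiv (mset Ss) (mset Ts)"
proof -
  let ?Gs = "map ugraph Ss" and ?Hs = "map ugraph Ts"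
  have wfS': "\<forall>S\<in>set Ss. wf_sgraph S" and wfT': "\<forall>S\<in>set Ts. wf_sgraph S" using wfS wfT by auto
  have wfG: "\<forall>G\<in>set ?Gs. wf_graph G" and wfH: "\<forall>G\<in>set ?Hs. wf_graph G"
    using wfS wfT by (auto simp: wf_sgraph_def)
  note f = equiv_via_iso[OF via, unfolded ugraph_sprod]
  define g where "g = inv_into (prod_verts ?Gs) f"
  have via': "equiv_via g (h \<circ> g) (sprod_list Ts) (sprod_list Ss)"
    using equiv_via_sym[OF via] wf_gprod[OF wfH] by (simp add: g_def)
  note g = equiv_via_iso[OF via', unfolded ugraph_sprod]
  have gf: "g (f x) = x" if "x \<in> prod_verts ?Gs" for x
    using that graph_iso_inj[OF f] by (simp add: g_def)
  have fg: "f (g y) = y" if "y \<in> prod_verts ?Hs" for y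
    using that f by (simp add: g_def graph_iso_def bij_betw_def f_inv_into_f)
  have connG: "connected_graph (gprod_list ?Gs)" using conn by simp
  have connH: "connected_graph (gprod_list ?Hs)"
    using connected_graph_iso[OF f wf_gprod[OF wfG] connG] .
  obtain a where a: "a \<in> prod_verts ?Gs" using connG by (auto simp: connected_graph_def)
  define b where "b = f a"
  have b: "b \<in> prod_verts ?Hs" using graph_iso_mem[OF f] a by (simp add: b_def)
  have gb: "g b = a" using gf[OF a] by (simp add: b_def)
  have cG: "connected_graph (ugraph (Ss ! i))" if "i < length Ss" for i
    using connected_factor[OF connG, of i] that by simp
  have cH: "connected_graph (ugraph (Ts ! j))" if "j < length Ts" for j
    using connected_factor[OF connH, of j] that by simp
  have "\<forall>i\<in>{..<length Ss}. \<exists>j<length Ts. \<forall>v\<in>sverts (Ss ! i). \<forall>k<length Ts. k \<noteq> j \<longrightarrow> f (a[i := v]) ! k = f a ! k"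
    using s_prime_layer_image[OF wfS' wfT' via a _ cG _ ne(2)] primes(1) by simp
  then obtain \<pi> where \<pi>: "\<And>i. i < length Ss \<Longrightarrow> \<pi> i < length Ts"
    and \<pi>': "\<And>i. i < length Ss \<Longrightarrow> \<forall>v\<in>sverts (Ss ! i). \<forall>k<length ?Hs. k \<noteq> \<pi> i \<longrightarrow> f (a[i := v]) ! k = f a ! k"
    unfolding length_map bchoice_iff by blast
  have "\<forall>j\<in>{..<length Ts}. \<exists>i<length Ss. \<forall>v\<in>sverts (Ts ! j). \<forall>k<length Ss. k \<noteq> i \<longrightarrow> g (b[j := v]) ! k = g b ! k"
    using s_prime_layer_image[OF wfT' wfS' via' b _ cH _ ne(1)] primes(2) by simp
  then obtain \<rho> where \<rho>: "\<And>j. j < length Ts \<Longrightarrow> \<rho> j < length Ss"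
    and \<rho>': "\<And>j. j < length Ts \<Longrightarrow> \<forall>v\<in>sverts (Ts ! j). \<forall>k<length ?Gs. k \<noteq> \<rho> j \<longrightarrow> g (b[j := v]) ! k = g b ! k"
    unfolding length_map bchoice_iff by blast
  have F: "f (a[i := v]) = b[\<pi> i := f (a[i := v]) ! \<pi> i]" "f (a[i := v]) ! \<pi> i \<in> sverts (Ts ! \<pi> i)"
    if "i < length Ss" "v \<in> sverts (Ss ! i)" for i v
    using layer_image_update[OF f a, of v i "\<pi> i"] that \<pi>[OF that(1)] \<pi>'[OF that(1)] by (auto simp: b_def)
  have G: "g (b[j := w]) = a[\<rho> j := g (b[j := w]) ! \<rho> j]" "g (b[j := w]) ! \<rho> j \<in> sverts (Ss ! \<rho> j)"
    if "j < length Ts" "w \<in> sverts (Ts ! j)" for j w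
    using layer_image_update[OF g b, of w j "\<rho> j"] that \<rho>[OF that(1)] \<rho>'[OF that(1)] gb by auto
  have upG: "a[i := v] \<in> prod_verts ?Gs" if "i < length Ss" "v \<in> sverts (Ss ! i)" for i v
    using prod_verts_update[OF a, of v i] that by simp
  have upH: "b[j := w] \<in> prod_verts ?Hs" if "j < length Ts" "w \<in> sverts (Ts ! j)" for j w
    using prod_verts_update[OF b, of w j] that by simp
  have la: "length a = length Ss" and lb: "length b = length Ts"
    using length_prod_verts[OF a] length_prod_verts[OF b] by simp_all
  \<comment> \<open>Going forth and back returns every vertex of layer \<open>i\<close>, yet lands
    in layer \<open>\<rho> (\<pi> i)\<close>. The edge in the factor supplies a vertex off the base
    point, and for different indices it cannot lie in both layers.\<close>
  have \<rho>\<pi>: "\<rho> (\<pi> i) = i" if i: "i < length Ss" for i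
  proof (rule ccontr)
    assume "\<rho> (\<pi> i) \<noteq> i"
    have "wf_graph (ugraph (Ss ! i))" "sedges (Ss ! i) \<noteq> {}" using wfS i by (auto simp: wf_sgraph_def)
    then obtain v where v: "v \<in> sverts (Ss ! i)" "v \<noteq> a ! i" by (rule edge_other_vertex)
    have "g (f (a[i := v])) = a[\<rho> (\<pi> i) := g (f (a[i := v])) ! \<rho> (\<pi> i)]"
      using G(1)[OF \<pi>[OF i] F(2)[OF i v(1)]] F(1)[OF i v(1)] by simp
    then have "a[i := v] ! i = a[\<rho> (\<pi> i) := a[i := v] ! \<rho> (\<pi> i)] ! i"
      using gf[OF upG[OF i v(1)]] by simp
    then show False using \<open>\<rho> (\<pi> i) \<noteq> i\<close> v(2) la i by simp
  qed
  have \<pi>\<rho>: "\<pi> (\<rho> j) = j" if j: "j < length Ts" for j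
  proof (rule ccontr)
    assume "\<pi> (\<rho> j) \<noteq> j"
    have "wf_graph (ugraph (Ts ! j))" "sedges (Ts ! j) \<noteq> {}" using wfT j by (auto simp: wf_sgraph_def)
    then obtain w where w: "w \<in> sverts (Ts ! j)" "w \<noteq> b ! j" by (rule edge_other_vertex)
    have "f (g (b[j := w])) = b[\<pi> (\<rho> j) := f (g (b[j := w])) ! \<pi> (\<rho> j)]"
      using F(1)[OF \<rho>[OF j] G(2)[OF j w(1)]] G(1)[OF j w(1)] by simp
    then have "b[j := w] ! j = b[\<pi> (\<rho> j) := b[j := w] ! \<pi> (\<rho> j)] ! j"
      using fg[OF upH[OF j w(1)]] by simp
    then show False using \<open>\<pi> (\<rho> j) \<noteq> j\<close> w(2) lb j by simp
  qed
  have bij: "bij_betw \<pi> {..<length Ss} {..<length Ts}"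
    by (rule bij_betw_byWitness[where f' = \<rho>]) (use \<rho>\<pi> \<pi>\<rho> \<pi> \<rho> in auto)
  have eqv: "s_equiv (Ss ! i) (Ts ! \<pi> i)" if i: "i < length Ss" for i
  proof -
    define j where "j = \<pi> i"
    have j: "j < length Ts" using \<pi>[OF i] by (simp add: j_def)
    have \<rho>j: "\<rho> j = i" using \<rho>\<pi>[OF i] by (simp add: j_def)
    define k where "k = (\<lambda>v. f (a[i := v]) ! j)"
    have k: "f (a[i := v]) = b[j := k v]" "k v \<in> sverts (Ts ! j)" if "v \<in> sverts (Ss ! i)" for v
      using F[OF i that] by (simp_all add: k_def j_def)
    have "inj_on k (sverts (Ss ! i))"
    proof (rule inj_onI)
      fix u v assume uv: "u \<in> sverts (Ss ! i)" "v \<in> sverts (Ss ! i)" "k u = k v"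
      then have "a[i := u] = a[i := v]" using k(1) gf[OF upG[OF i]] by metis
      then show "u = v" using la i by (metis nth_list_update_eq)
    qed
    moreover have "k ` sverts (Ss ! i) = sverts (Ts ! j)"
    proof (intro equalityI subsetI)
      \<comment> \<open>The inverse map takes layer \<open>j\<close> into layer \<open>i\<close>,
        since \<open>\<rho> j = i\<close>; the coordinate read off there is the preimage of
        \<open>w\<close>.\<close>
      fix w assume w: "w \<in> sverts (Ts ! j)"
      let ?v = "g (b[j := w]) ! i"
      have v: "?v \<in> sverts (Ss ! i)" "g (b[j := w]) = a[i := ?v]" using G[OF j w] \<rho>j by simp_all
      then have "b[j := w] = b[j := k ?v]" using k(1)[OF v(1)] fg[OF upH[OF j w]] by simp
      then have "w = k ?v" using lb j by (metis nth_list_update_eq)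
      then show "w \<in> k ` sverts (Ss ! i)" using v(1) by blast
    qed (use k in auto)
    moreover have "{u, v} \<in> sedges (Ss ! i) \<longleftrightarrow> {k u, k v} \<in> sedges (Ts ! j)"
      if uv: "u \<in> sverts (Ss ! i)" "v \<in> sverts (Ss ! i)" for u v
    proof -
      have "{u, v} \<in> sedges (Ss ! i) \<longleftrightarrow> {a[i := u], a[i := v]} \<in> gedges (gprod_list ?Gs)"
        using gprod_edge_update_iff(1)[OF wfG a, of i u v] uv i by simp
      also have "\<dots> \<longleftrightarrow> {f (a[i := u]), f (a[i := v])} \<in> gedges (gprod_list ?Hs)"
        using graph_iso_edge_iff[OF f] upG[OF i] uv by simp
      also have "\<dots> \<longleftrightarrow> {k u, k v} \<in> sedges (Ts ! j)"
        using gprod_edge_update_iff(1)[OF wfH b, of j "k u" "k v"] k uv j by simp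
      finally show ?thesis .
    qed
    ultimately have iso: "graph_iso k (ugraph (Ss ! i)) (ugraph (Ts ! j))"
      by (simp add: graph_iso_def bij_betw_def)
    have "sgn (Ss ! i) {u, v} = h (a[i := u]) * h (a[i := v]) * sgn (Ts ! j) {k u, k v}"
      if e: "{u, v} \<in> sedges (Ss ! i)" for u v
    proof -
      have uv: "u \<in> sverts (Ss ! i)" "v \<in> sverts (Ss ! i)"
        using wf_graph_edgeD[OF _ e] wfS i by (simp_all add: wf_sgraph_def)
      have sG: "prod_step ?Gs i (a[i := u]) (a[i := v])"
        using gprod_edge_update_iff(2)[OF wfG a, of i u v] uv i e by simp
      have sH: "prod_step ?Hs j (b[j := k u]) (b[j := k v])"
        using gprod_edge_update_iff(2)[OF wfH b, of j "k u" "k v"] k uv j e graph_iso_edge_iff[OF iso] by simp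
      have "{a[i := u], a[i := v]} \<in> sedges (sprod_list Ss)" using sG by (auto simp: gprod_edge_iff)
      then have "sgn (sprod_list Ss) {a[i := u], a[i := v]} =
          h (a[i := u]) * h (a[i := v]) * sgn (sprod_list Ts) {b[j := k u], b[j := k v]}"
        using via k(1)[OF uv(1)] k(1)[OF uv(2)] by (simp add: equiv_via_def)
      then show ?thesis using sgn_sprod[OF wfS' sG] sgn_sprod[OF wfT' sH] la lb i j by simp
    qed
    moreover have "h (a[i := v]) \<in> {1, -1}" if "v \<in> sverts (Ss ! i)" for v
      using via upG[OF i that] by (simp add: equiv_via_def)
    ultimately have "equiv_via k (\<lambda>v. h (a[i := v])) (Ss ! i) (Ts ! j)"
      using iso by (simp add: equiv_via_def)
    then show ?thesis using s_equiv_iff_equiv_via[of "Ss ! i" "Ts ! j"] wfS i by (auto simp: j_def)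
  qed
  \<comment> \<open>\<open>rel_mset\<close> asks for two lists related entry by entry, so
    \<open>Ts\<close> is rearranged along the bijection \<open>\<pi>\<close>.\<close>
  let ?ys = "map (\<lambda>i. Ts ! \<pi> i) [0..<length Ss]"
  have "mset ?ys = image_mset ((!) Ts) (image_mset \<pi> (mset_set {..<length Ss}))"
    by (simp add: multiset.map_comp comp_def lessThan_atLeast0 flip: mset_upt)
  also have "image_mset \<pi> (mset_set {..<length Ss}) = mset_set {..<length Ts}"
    using bij by (simp add: bij_betw_def image_mset_mset_set)
  also have "image_mset ((!) Ts) (mset_set {..<length Ts}) = mset Ts"
    by (metis lessThan_atLeast0 map_nth mset_map mset_upt)
  finally have "mset ?ys = mset Ts" .
  moreover have "list_all2 s_equiv Ss ?ys" using eqv by (simp add: list_all2_conv_all_nth)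
  ultimately show ?thesis unfolding rel_mset_def by blast
qed

subsection \<open>Grouping prime factors\<close>

text \<open>As \<open>x\<close> and \<open>y\<close> agree outside \<open>js\<close>, the coordinate
  changed by a step lies in \<open>js\<close>; as \<open>js\<close> is distinct, it occurs only once
  in the shortened tuples.\<close>

lemma prod_step_restrict:
  assumes wf: "\<forall>G\<in>set Gs. wf_graph G" and x: "x \<in> prod_verts Gs" and y: "y \<in> prod_verts Gs"
    and js: "distinct js" "set js \<subseteq> {..<length Gs}"
    and out: "\<And>i. \<lbrakk>i < length Gs; i \<notin> set js\<rbrakk> \<Longrightarrow> x ! i = y ! i"
  shows "(\<exists>i. prod_step Gs i x y) \<longleftrightarrow>
    (\<exists>m. prod_step (map ((!) Gs) js) m (map ((!) x) js) (map ((!) y) js))"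
proof -
  have P: "map ((!) z) js \<in> prod_verts (map ((!) Gs) js)" if "z \<in> prod_verts Gs" for z
    using that js(2) nth_prod_verts[OF that] by (auto simp: prod_verts_def subset_iff)
  show ?thesis
  proof
    assume "\<exists>i. prod_step Gs i x y"
    then obtain i where i: "prod_step Gs i x y" ..
    then have "i \<in> set js" using prod_step_nth_neq[OF i wf] out by (auto simp: prod_step_def)
    then obtain m where m: "m < length js" "js ! m = i" by (auto simp: in_set_conv_nth)
    have "x ! (js ! k) = y ! (js ! k)" if "k < length js" "k \<noteq> m" for k
    proof -
      have "js ! k \<noteq> i" using that m js(1) by (auto simp: nth_eq_iff_index_eq)
      moreover have "js ! k < length Gs" using that(1) js(2) nth_mem by blast
      ultimately show ?thesis using i by (simp add: prod_step_def)
    qed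
    then have "prod_step (map ((!) Gs) js) m (map ((!) x) js) (map ((!) y) js)"
      using i m P[OF x] P[OF y] by (simp add: prod_step_def)
    then show "\<exists>m. prod_step (map ((!) Gs) js) m (map ((!) x) js) (map ((!) y) js)" ..
  next
    assume "\<exists>m. prod_step (map ((!) Gs) js) m (map ((!) x) js) (map ((!) y) js)"
    then obtain m where m: "prod_step (map ((!) Gs) js) m (map ((!) x) js) (map ((!) y) js)" ..
    then have ml: "m < length js" by (simp add: prod_step_def)
    have "x ! k = y ! k" if "k < length Gs" "k \<noteq> js ! m" for k
    proof (cases "k \<in> set js")
      case True
      then obtain l where "l < length js" "js ! l = k" by (auto simp: in_set_conv_nth)
      then show ?thesis using m that by (auto simp: prod_step_def)
    qed (use out that in blast)
    moreover have "js ! m < length Gs" using ml js(2) nth_mem by blast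
    ultimately have "prod_step Gs (js ! m) x y" using m ml x y by (simp add: prod_step_def)
    then show "\<exists>i. prod_step Gs i x y" ..
  qed
qed

text \<open>The values of \<open>p\<close> below \<open>l\<close> sort the entries of
  \<open>xs\<close> into classes, and each entry is counted in exactly one. In
  \<open>prime_decomp_finer\<close> the classes are the groups of prime factors.\<close>

lemma sum_list_mset_filter:
  assumes "\<forall>x\<in>set xs. p x < l"
  shows "sum_list (map (\<lambda>j. mset (map f (filter (\<lambda>x. p x = j) xs))) [0..<l]) = mset (map f xs)"
  using assms
proof (induction xs)
  case Nil
  then show ?case by (simp add: sum_list_0)
next
  case (Cons x xs)
  have "sum_list (map (\<lambda>j. mset (map f (filter (\<lambda>x. p x = j) (x # xs)))) [0..<l]) =
    sum_list (map (\<lambda>j. (if p x = j then {#f x#} else {#}) + mset (map f (filter (\<lambda>x. p x = j) xs))) [0..<l])"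
    by (intro arg_cong[of _ _ sum_list] map_cong) auto
  also have "\<dots> = sum_list (map (\<lambda>j. if p x = j then {#f x#} else {#}) [0..<l]) + mset (map f xs)"
    using Cons by (simp add: sum_list_addf)
  also have "sum_list (map (\<lambda>j. if p x = j then {#f x#} else {#}) [0..<l]) = {#f x#}"
    using Cons.prems by (simp add: interv_sum_list_conv_sum_set_nat sum.delta)
  finally show ?case by simp
qed

text \<open>Layers of the second product may spread over several coordinates of the first, so only
  \<open>\<pi>\<close> is available. Pulled back by \<open>g\<close>, layer \<open>j\<close> is a
  box that is full in the coordinates sent to \<open>j\<close> by \<open>\<pi>\<close> and constant
  in the others; forgetting the constant ones gives the isomorphism.\<close>

lemma s_prime_factors_group:
  assumes wfS: "\<forall>S\<in>set Ss. wf_sgraph S" and wfT: "\<forall>T\<in>set Ts. wf_sgraph T \<and> sedges T \<noteq> {}"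
    and ne: "Ts \<noteq> []" and primes: "\<forall>S\<in>set Ss. s_prime S"
    and via: "equiv_via f h (sprod_list Ss) (sprod_list Ts)"
    and conn: "connected_graph (ugraph (sprod_list Ss))"
  shows "\<exists>\<pi>. (\<forall>i<length Ss. \<pi> i < length Ts) \<and> (\<forall>j<length Ts.
    filter (\<lambda>i. \<pi> i = j) [0..<length Ss] \<noteq> [] \<and>
    isomorphic (ugraph (Ts ! j)) (gprod_list (map ((!) (map ugraph Ss)) (filter (\<lambda>i. \<pi> i = j) [0..<length Ss]))))"
proof -
  let ?Gs = "map ugraph Ss" and ?Hs = "map ugraph Ts"
  have wfT': "\<forall>S\<in>set Ts. wf_sgraph S" using wfT by auto
  have wfG: "\<forall>G\<in>set ?Gs. wf_graph G" and wfH: "\<forall>G\<in>set ?Hs. wf_graph G"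
    using wfS wfT by (auto simp: wf_sgraph_def)
  note f = equiv_via_iso[OF via, unfolded ugraph_sprod]
  define g where "g = inv_into (prod_verts ?Gs) f"
  have g: "graph_iso g (gprod_list ?Hs) (gprod_list ?Gs)" using graph_iso_inv[OF f] by (simp add: g_def)
  have gf: "g (f x) = x" if "x \<in> prod_verts ?Gs" for x
    using that graph_iso_inj[OF f] by (simp add: g_def)
  have fg: "f (g y) = y" if "y \<in> prod_verts ?Hs" for y
    using that f by (simp add: g_def graph_iso_def bij_betw_def f_inv_into_f)
  have connG: "connected_graph (gprod_list ?Gs)" using conn by simp
  have connH: "connected_graph (gprod_list ?Hs)"
    using connected_graph_iso[OF f wf_gprod[OF wfG] connG] .
  obtain a where a: "a \<in> prod_verts ?Gs" using connG by (auto simp: connected_graph_def)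
  define b where "b = f a"
  have b: "b \<in> prod_verts ?Hs" using graph_iso_mem[OF f] a by (simp add: b_def)
  have la: "length a = length Ss" and lb: "length b = length Ts"
    using length_prod_verts[OF a] length_prod_verts[OF b] by simp_all
  have cG: "connected_graph (ugraph (Ss ! i))" if "i < length Ss" for i
    using connected_factor[OF connG, of i] that by simp
  have "\<forall>i\<in>{..<length Ss}. \<exists>j<length Ts. \<forall>v\<in>sverts (Ss ! i). \<forall>k<length Ts. k \<noteq> j \<longrightarrow> f (a[i := v]) ! k = f a ! k"
    using s_prime_layer_image[OF wfS wfT' via a _ cG _ ne] primes by simp
  then obtain \<pi> where \<pi>: "\<And>i. i < length Ss \<Longrightarrow> \<pi> i < length Ts"
    and \<pi>': "\<And>i. i < length Ss \<Longrightarrow> \<forall>v\<in>sverts (Ss ! i). \<forall>k<length ?Hs. k \<noteq> \<pi> i \<longrightarrow> f (a[i := v]) ! k = f a ! k"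
    unfolding length_map bchoice_iff by blast
  have F: "f (a[i := v]) = b[\<pi> i := f (a[i := v]) ! \<pi> i]" "f (a[i := v]) ! \<pi> i \<in> sverts (Ts ! \<pi> i)"
    if "i < length Ss" "v \<in> sverts (Ss ! i)" for i v
    using layer_image_update[OF f a, of v i "\<pi> i"] that \<pi>[OF that(1)] \<pi>'[OF that(1)] by (auto simp: b_def)
  have upG: "a[i := v] \<in> prod_verts ?Gs" if "i < length Ss" "v \<in> sverts (Ss ! i)" for i v
    using prod_verts_update[OF a, of v i] that by simp
  have "filter (\<lambda>i. \<pi> i = j) [0..<length Ss] \<noteq> [] \<and>
    isomorphic (ugraph (Ts ! j)) (gprod_list (map ((!) ?Gs) (filter (\<lambda>i. \<pi> i = j) [0..<length Ss])))"
    if j: "j < length Ts" for j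
  proof -
    define js where "js = filter (\<lambda>i. \<pi> i = j) [0..<length Ss]"
    have js: "distinct js" "set js = {i. i < length Ss \<and> \<pi> i = j}" by (auto simp: js_def)
    let ?V = "sverts (Ts ! j)"
    define K where "K = (\<lambda>w. g (b[j := w]))"
    have upH: "b[j := w] \<in> prod_verts ?Hs" if "w \<in> ?V" for w
      using prod_verts_update[OF b, of w j] that j by simp
    have KP: "K w \<in> prod_verts ?Gs" if "w \<in> ?V" for w
      using graph_iso_mem[OF g] upH[OF that] by (simp add: K_def)
    have Kinj: "w = w'" if "w \<in> ?V" "w' \<in> ?V" "K w = K w'" for w w'
    proof -
      have "b[j := w] = b[j := w']" using that fg[OF upH] by (metis K_def)
      then show ?thesis using lb j by (metis nth_list_update_eq)
    qed
    have box: "is_box ?Gs (K ` ?V)"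
      using layer_image_is_box[OF wfH wfG g b, of j] j connected_factor[OF connH, of j] by (simp add: K_def)
    have bj: "b ! j \<in> ?V" using nth_prod_verts[OF b, of j] j by simp
    have aK: "K (b ! j) = a" using gf[OF a] by (simp add: K_def b_def)
    \<comment> \<open>By the box property, \<open>a\<close> with its entry at \<open>i\<close>
      replaced by that of \<open>K w\<close> lies in the pulled back layer. Its image under
      \<open>f\<close> is then both in layer \<open>j\<close> and in layer \<open>\<pi> i\<close>
      through \<open>b\<close>, hence equals \<open>b\<close>, and the replacement changed
      nothing.\<close>
    have out: "K w ! i = a ! i" if w: "w \<in> ?V" and i: "i < length Ss" "\<pi> i \<noteq> j" for w i
    proof -
      let ?v = "K w ! i"
      have v: "?v \<in> sverts (Ss ! i)" using nth_prod_verts[OF KP[OF w], of i] i by simp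
      have "(K (b ! j))[i := ?v] \<in> K ` ?V" using box bj w i by (simp add: is_box_def)
      then have "a[i := ?v] \<in> K ` ?V" using aK by simp
      then obtain w' where w': "w' \<in> ?V" "a[i := ?v] = K w'" by blast
      then have fb: "f (a[i := ?v]) = b[j := w']" using fg[OF upH[OF w'(1)]] by (simp add: K_def)
      have "b[j := w'] = b"
      proof (rule nth_equalityI)
        fix k assume "k < length (b[j := w'])"
        show "b[j := w'] ! k = b ! k"
          using F(1)[OF i(1) v] fb i(2) by (cases "k = j") (metis nth_list_update_neq)+
      qed simp
      then have "a[i := ?v] = a" using fb gf[OF upG[OF i(1) v]] gf[OF a] by (simp add: b_def)
      then show ?thesis using la i(1) by (metis nth_list_update_eq)
    qed
    \<comment> \<open>Each entry of \<open>x\<close> occurs in the box separately: at a coordinate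
      sent to \<open>j\<close>, the vertex \<open>a[i := x ! i]\<close> is mapped by
      \<open>f\<close> into layer \<open>j\<close>; at the others \<open>a\<close> itself is a
      witness.\<close>
    have inK: "x \<in> K ` ?V" if x: "x \<in> prod_verts ?Gs"
      and xa: "\<And>i. \<lbrakk>i < length Ss; \<pi> i \<noteq> j\<rbrakk> \<Longrightarrow> x ! i = a ! i" for x
    proof (rule is_box_mem[OF box x])
      fix i assume "i < length ?Gs"
      then have i: "i < length Ss" by simp
      show "\<exists>w\<in>K ` ?V. w ! i = x ! i"
      proof (cases "\<pi> i = j")
        case True
        have xi: "x ! i \<in> sverts (Ss ! i)" using nth_prod_verts[OF x, of i] i by simp
        have "a[i := x ! i] = K (f (a[i := x ! i]) ! j)"
          using F(1)[OF i xi] gf[OF upG[OF i xi]] True by (metis K_def)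
        moreover have "f (a[i := x ! i]) ! j \<in> ?V" using F(2)[OF i xi] True by simp
        ultimately have "a[i := x ! i] \<in> K ` ?V" by blast
        then show ?thesis using la i by (intro bexI[of _ "a[i := x ! i]"]) simp_all
      next
        case False
        then show ?thesis using xa[OF i] aK bj by force
      qed
    qed
    define R where "R = (\<lambda>w. map ((!) (K w)) js)"
    have "inj_on R ?V"
    proof (rule inj_onI)
      fix w w' assume w: "w \<in> ?V" "w' \<in> ?V" "R w = R w'"
      have "K w = K w'"
      proof (rule prod_verts_eqI[OF KP[OF w(1)] KP[OF w(2)]])
        fix i assume "i < length ?Gs"
        then have i: "i < length Ss" by simp
        show "K w ! i = K w' ! i"
        proof (cases "\<pi> i = j")
          case True
          then have "i \<in> set js" using js i by simp
          then show ?thesis using w(3) by (simp add: R_def)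
        qed (use out i w in simp)
      qed
      then show "w = w'" using Kinj w by blast
    qed
    moreover have "R ` ?V = prod_verts (map ((!) ?Gs) js)"
    proof (intro equalityI subsetI)
      fix z assume "z \<in> R ` ?V"
      then obtain w where "w \<in> ?V" "z = R w" by blast
      then show "z \<in> prod_verts (map ((!) ?Gs) js)"
        using KP[of w] js nth_mem[of _ js] by (simp add: R_def prod_verts_def)
    next
      fix z assume z: "z \<in> prod_verts (map ((!) ?Gs) js)"
      \<comment> \<open>The preimage of \<open>z\<close> has the entries of \<open>z\<close> at the
        positions listed in \<open>js\<close> and those of \<open>a\<close> elsewhere; distinctness
        of \<open>js\<close> makes the lookup unambiguous.\<close>
      define x where "x = map (\<lambda>i. if \<pi> i = j then the (map_of (zip js z) i) else a ! i) [0..<length Ss]"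
      have lz: "length z = length js" using length_prod_verts[OF z] by simp
      have xj: "x ! (js ! m) = z ! m" if "m < length js" for m
      proof -
        have "js ! m \<in> set js" using that by simp
        then show ?thesis using js map_of_zip_nth[of js z m] lz that by (simp add: x_def)
      qed
      have xo: "x ! i = a ! i" if "i < length Ss" "\<pi> i \<noteq> j" for i using that by (simp add: x_def)
      have "x ! i \<in> gverts (?Gs ! i)" if i: "i < length Ss" for i
      proof (cases "\<pi> i = j")
        case True
        then have "i \<in> set js" using js i by simp
        then obtain m where m: "m < length js" "js ! m = i" by (auto simp: in_set_conv_nth)
        then show ?thesis using nth_prod_verts[OF z, of m] xj[OF m(1)] by simp
      next
        case False
        then show ?thesis using xo[OF i] nth_prod_verts[OF a, of i] i by simp
      qed
      then have "x \<in> prod_verts ?Gs" by (simp add: prod_verts_def x_def)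
      then obtain w where w: "w \<in> ?V" "x = K w" using inK xo by blast
      have "z = R w" using xj lz w by (simp add: R_def list_eq_iff_nth_eq)
      then show "z \<in> R ` ?V" using w by blast
    qed
    moreover have "{w, w'} \<in> sedges (Ts ! j) \<longleftrightarrow> {R w, R w'} \<in> gedges (gprod_list (map ((!) ?Gs) js))"
      if w: "w \<in> ?V" "w' \<in> ?V" for w w'
    proof -
      have "{w, w'} \<in> sedges (Ts ! j) \<longleftrightarrow> {b[j := w], b[j := w']} \<in> gedges (gprod_list ?Hs)"
        using gprod_edge_update_iff(1)[OF wfH b, of j w w'] w j by simp
      also have "\<dots> \<longleftrightarrow> {K w, K w'} \<in> gedges (gprod_list ?Gs)"
        using graph_iso_edge_iff[OF g] upH w by (simp add: K_def)
      also have "\<dots> \<longleftrightarrow> {R w, R w'} \<in> gedges (gprod_list (map ((!) ?Gs) js))"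
        unfolding gprod_edge_iff R_def
        by (rule prod_step_restrict[OF wfG KP[OF w(1)] KP[OF w(2)]]) (use js out w in auto)
      finally show ?thesis .
    qed
    ultimately have iso: "isomorphic (ugraph (Ts ! j)) (gprod_list (map ((!) ?Gs) js))"
      unfolding isomorphic_def graph_iso_def bij_betw_def gverts_gprod by (intro exI[of _ R]) blast
    \<comment> \<open>With no coordinates left \<open>R\<close> would be constant, but it is
      injective and the factor has two vertices.\<close>
    have "js \<noteq> []"
    proof
      assume "js = []"
      have "wf_graph (ugraph (Ts ! j))" "sedges (Ts ! j) \<noteq> {}" using wfT j by (auto simp: wf_sgraph_def)
      then obtain w where "w \<in> ?V" "w \<noteq> b ! j" by (rule edge_other_vertex)
      then show False using \<open>inj_on R ?V\<close> bj \<open>js = []\<close> by (auto simp: R_def inj_on_def)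
    qed
    then show ?thesis using iso by (simp add: js_def)
  qed
  then show ?thesis using \<pi> by (intro exI[of _ \<pi>]) blast
qed

subsection \<open>Refining products\<close>

text \<open>An \<open>s\<close>-prime graph is its own decomposition, but the product of a
  one-element list has one-element lists as vertices.\<close>

lemma equiv_via_sprod_singleton:
  assumes "wf_sgraph S"
  shows "equiv_via (\<lambda>v. [v]) (\<lambda>_. 1) S (sprod_list [S])"
proof -
  have P: "prod_verts [ugraph S] = (\<lambda>v. [v]) ` sverts S"
    by (auto simp: prod_verts_def length_Suc_conv)
  have step: "prod_step [ugraph S] i [u] [v] \<longleftrightarrow> i = 0 \<and> u \<in> sverts S \<and> v \<in> sverts S \<and> {u, v} \<in> sedges S"
    for i u v by (auto simp: prod_step_def P)
  have "graph_iso (\<lambda>v. [v]) (ugraph S) (ugraph (sprod_list [S]))"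
    by (auto simp: graph_iso_def bij_betw_def inj_on_def P gprod_edge_iff step)
  moreover have "sgn (sprod_list [S]) {[u], [v]} = sgn S {u, v}" if "{u, v} \<in> sedges S" for u v
    using sgn_sprod[of "[S]" 0 "[u]" "[v]"] step[of 0 u v] assms that
      wf_graph_edgeD[OF wf_sgraph_wf_graph[OF assms] that] by simp
  ultimately show ?thesis by (simp add: equiv_via_def)
qed

lemma prod_verts_append:
  "prod_verts (Gs @ Hs) = {u @ w | u w. u \<in> prod_verts Gs \<and> w \<in> prod_verts Hs}"
proof (intro equalityI subsetI)
  fix z assume z: "z \<in> prod_verts (Gs @ Hs)"
  let ?n = "length Gs"
  have "z = take ?n z @ drop ?n z" by simp
  moreover have "z ! i \<in> gverts (Gs ! i)" if "i < ?n" for i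
    using nth_prod_verts[OF z, of i] that by (simp add: nth_append)
  then have "take ?n z \<in> prod_verts Gs" using length_prod_verts[OF z] by (simp add: prod_verts_def)
  moreover have "z ! (?n + i) \<in> gverts (Hs ! i)" if "i < length Hs" for i
    using nth_prod_verts[OF z, of "?n + i"] that by (simp add: nth_append)
  then have "drop ?n z \<in> prod_verts Hs" using length_prod_verts[OF z] by (simp add: prod_verts_def)
  ultimately show "z \<in> {u @ w | u w. u \<in> prod_verts Gs \<and> w \<in> prod_verts Hs}" by blast
qed (auto simp: prod_verts_def nth_append)

lemma append_in_prod_verts:
  "\<lbrakk>u \<in> prod_verts Gs; w \<in> prod_verts Hs\<rbrakk> \<Longrightarrow> u @ w \<in> prod_verts (Gs @ Hs)"
  by (auto simp: prod_verts_def nth_append)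

lemma prod_step_append_left:
  assumes "prod_step Gs i u u'" "w \<in> prod_verts Hs"
  shows "prod_step (Gs @ Hs) i (u @ w) (u' @ w)"
  using assms length_prod_verts[of u Gs] length_prod_verts[of u' Gs]
  by (simp add: prod_step_def append_in_prod_verts nth_append)

lemma prod_step_append_right:
  assumes "prod_step Hs i w w'" "u \<in> prod_verts Gs"
  shows "prod_step (Gs @ Hs) (length Gs + i) (u @ w) (u @ w')"
  using assms length_prod_verts[of u Gs]
  by (auto simp: prod_step_def append_in_prod_verts nth_append)

lemma prod_step_appendD:
  assumes "prod_step (Gs @ Hs) i (u @ w) (u' @ w')" and u: "u \<in> prod_verts Gs" "u' \<in> prod_verts Gs"
    and w: "w \<in> prod_verts Hs" "w' \<in> prod_verts Hs"
  shows "(w = w' \<and> prod_step Gs i u u') \<or> (u = u' \<and> prod_step Hs (i - length Gs) w w')"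
proof -
  have len: "length u = length Gs" "length u' = length Gs" "length w = length Hs" "length w' = length Hs"
    using u w length_prod_verts by auto
  have oth: "(u @ w) ! k = (u' @ w') ! k" if "k < length Gs + length Hs" "k \<noteq> i" for k
    using assms(1) that by (simp add: prod_step_def)
  have i: "i < length Gs + length Hs" "{(u @ w) ! i, (u' @ w') ! i} \<in> gedges ((Gs @ Hs) ! i)"
    using assms(1) by (simp_all add: prod_step_def)
  show ?thesis
  proof (cases "i < length Gs")
    case True
    have "w ! k = w' ! k" if "k < length Hs" for k
      using oth[of "length Gs + k"] that True len by (simp add: nth_append)
    then have "w = w'" using len by (simp add: list_eq_iff_nth_eq)
    moreover have "u ! k = u' ! k" if "k < length Gs" "k \<noteq> i" for k
      using oth[of k] that len by (simp add: nth_append)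
    ultimately show ?thesis using True i u len by (simp add: prod_step_def nth_append)
  next
    case False
    have "u ! k = u' ! k" if "k < length Gs" for k
      using oth[of k] that False len by (simp add: nth_append)
    then have "u = u'" using len by (simp add: list_eq_iff_nth_eq)
    moreover have "w ! k = w' ! k" if "k < length Hs" "k \<noteq> i - length Gs" for k
      using oth[of "length Gs + k"] that False len by (simp add: nth_append)
    ultimately show ?thesis using False i w len by (auto simp: prod_step_def nth_append)
  qed
qed

text \<open>Refines both factors of a splitting at once. The switching functions multiply: along an
  edge of \<open>A\<close> the coordinate in \<open>B\<close> is fixed, so the sign \<open>k\<close>
  occurs twice and cancels, and symmetrically for \<open>B\<close>.\<close>

lemma equiv_via_sprod_append:
  assumes wf: "wf_sgraph A" "wf_sgraph B" "\<forall>S\<in>set xs. wf_sgraph S" "\<forall>S\<in>set ys. wf_sgraph S"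
    and f: "equiv_via f h A (sprod_list xs)" and g: "equiv_via g k B (sprod_list ys)"
  shows "equiv_via (\<lambda>z. f (z ! 0) @ g (z ! 1)) (\<lambda>z. h (z ! 0) * k (z ! 1))
    (sprod_list [A, B]) (sprod_list (xs @ ys))"
proof -
  let ?X = "map ugraph xs" and ?Y = "map ugraph ys"
  let ?F = "\<lambda>z. f (z ! 0) @ g (z ! 1)"
  note fi = equiv_via_iso[OF f, unfolded ugraph_sprod] and gi = equiv_via_iso[OF g, unfolded ugraph_sprod]
  note edA = wf_graph_edgeD[OF wf_sgraph_wf_graph[OF wf(1)]] and edB = wf_graph_edgeD[OF wf_sgraph_wf_graph[OF wf(2)]]
  have fP: "f a \<in> prod_verts ?X" if "a \<in> sverts A" for a using graph_iso_mem[OF fi that] by simp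
  have gP: "g b \<in> prod_verts ?Y" if "b \<in> sverts B" for b using graph_iso_mem[OF gi that] by simp
  have lf: "length (f a) = length xs" if "a \<in> sverts A" for a using length_prod_verts[OF fP[OF that]] by simp
  have fim: "f ` sverts A = prod_verts ?X" and gim: "g ` sverts B = prod_verts ?Y"
    using fi gi by (simp_all add: graph_iso_def bij_betw_def)
  have h: "h a \<in> {1, -1}" if "a \<in> sverts A" for a using f that by (simp add: equiv_via_def)
  have k: "k b \<in> {1, -1}" if "b \<in> sverts B" for b using g that by (simp add: equiv_via_def)
  have finj: "f a = f a' \<longleftrightarrow> a = a'" if "a \<in> sverts A" "a' \<in> sverts A" for a a'
    using graph_iso_inj[OF fi] that by (auto dest: inj_onD)
  have ginj: "g b = g b' \<longleftrightarrow> b = b'" if "b \<in> sverts B" "b' \<in> sverts B" for b b'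
    using graph_iso_inj[OF gi] that by (auto dest: inj_onD)
  have fe: "{a, a'} \<in> sedges A \<longleftrightarrow> (\<exists>i. prod_step ?X i (f a) (f a'))" if "a \<in> sverts A" "a' \<in> sverts A" for a a'
    using graph_iso_edge_iff[OF fi that] by (simp add: gprod_edge_iff)
  have ge: "{b, b'} \<in> sedges B \<longleftrightarrow> (\<exists>i. prod_step ?Y i (g b) (g b'))" if "b \<in> sverts B" "b' \<in> sverts B" for b b'
    using graph_iso_edge_iff[OF gi that] by (simp add: gprod_edge_iff)
  have P: "prod_verts [ugraph A, ugraph B] = {[a, b] | a b. a \<in> sverts A \<and> b \<in> sverts B}"
    by (simp add: prod_verts_pair)
  have "inj_on ?F (prod_verts [ugraph A, ugraph B])"
    using finj ginj lf by (auto simp: P inj_on_def)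
  moreover have "?F ` prod_verts [ugraph A, ugraph B] = prod_verts (map ugraph (xs @ ys))"
  proof (intro equalityI subsetI)
    fix z assume "z \<in> prod_verts (map ugraph (xs @ ys))"
    then obtain u w where "u \<in> prod_verts ?X" "w \<in> prod_verts ?Y" "z = u @ w" by (auto simp: prod_verts_append)
    then obtain a b where "a \<in> sverts A" "b \<in> sverts B" "z = f a @ g b" unfolding fim[symmetric] gim[symmetric] by blast
    then show "z \<in> ?F ` prod_verts [ugraph A, ugraph B]" by (intro image_eqI[of _ _ "[a, b]"]) (auto simp: P)
  next
    fix z assume "z \<in> ?F ` prod_verts [ugraph A, ugraph B]"
    then show "z \<in> prod_verts (map ugraph (xs @ ys))" by (auto simp: P append_in_prod_verts[OF fP gP])
  qed
  moreover have edge: "(\<exists>i. prod_step [ugraph A, ugraph B] i z z') \<longleftrightarrow> (\<exists>i. prod_step (map ugraph (xs @ ys)) i (?F z) (?F z'))"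
    if zz: "z \<in> prod_verts [ugraph A, ugraph B]" "z' \<in> prod_verts [ugraph A, ugraph B]" for z z'
  proof -
    obtain a b a' b' where z: "z = [a, b]" "z' = [a', b']"
      and ab: "a \<in> sverts A" "b \<in> sverts B" "a' \<in> sverts A" "b' \<in> sverts B" using zz unfolding P by blast
    have "(\<exists>i. prod_step [ugraph A, ugraph B] i z z') \<longleftrightarrow>
      {a, a'} \<in> sedges A \<and> b = b' \<or> {b, b'} \<in> sedges B \<and> a = a'"
      using ab by (auto simp: z prod_step_pair)
    also have "\<dots> \<longleftrightarrow> (\<exists>i. prod_step (map ugraph (xs @ ys)) i (f a @ g b) (f a' @ g b'))" (is "?l \<longleftrightarrow> ?r")
    proof
      assume ?l
      then show ?r
      proof
        assume "{a, a'} \<in> sedges A \<and> b = b'"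
        then show ?r using fe ab prod_step_append_left[OF _ gP[OF ab(2)], of ?X _ "f a" "f a'"] by auto
      next
        assume "{b, b'} \<in> sedges B \<and> a = a'"
        then show ?r using ge ab prod_step_append_right[OF _ fP[OF ab(1)], of ?Y _ "g b" "g b'"] by auto
      qed
    next
      assume ?r
      then obtain i where "prod_step (?X @ ?Y) i (f a @ g b) (f a' @ g b')" by auto
      from prod_step_appendD[OF this fP[OF ab(1)] fP[OF ab(3)] gP[OF ab(2)] gP[OF ab(4)]]
      show ?l using fe ge finj ginj ab by blast
    qed
    finally show ?thesis by (simp add: z)
  qed
  ultimately have "graph_iso ?F (ugraph (sprod_list [A, B])) (ugraph (sprod_list (xs @ ys)))"
    unfolding graph_iso_def bij_betw_def ugraph_sprod gverts_gprod gprod_edge_iff list.map by simp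
  moreover have "sgn (sprod_list [A, B]) {z, z'} =
      (h (z ! 0) * k (z ! 1)) * (h (z' ! 0) * k (z' ! 1)) * sgn (sprod_list (xs @ ys)) {?F z, ?F z'}"
    if zz: "{z, z'} \<in> sedges (sprod_list [A, B])" for z z'
  proof -
    obtain i where st: "prod_step [ugraph A, ugraph B] i z z'" using zz unfolding ugraph_sprod gprod_edge_iff list.map by blast
    then have "z \<in> prod_verts [ugraph A, ugraph B]" "z' \<in> prod_verts [ugraph A, ugraph B]" by (simp_all add: prod_step_def)
    then obtain a b a' b' where z: "z = [a, b]" "z' = [a', b']"
      and ab: "a \<in> sverts A" "b \<in> sverts B" "a' \<in> sverts A" "b' \<in> sverts B" unfolding P by blast
    have wfAB: "\<forall>S\<in>set [A, B]. wf_sgraph S" and wfxy: "\<forall>S\<in>set (xs @ ys). wf_sgraph S" using wf by auto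
    note sg = sgn_sprod[OF wfAB, unfolded list.map, OF st]
    consider "i = 0" "{a, a'} \<in> sedges A" "b = b'" | "i = 1" "{b, b'} \<in> sedges B" "a = a'"
      using st by (auto simp: z prod_step_pair)
    then show ?thesis
    proof cases
      case 1
      obtain m where m: "prod_step ?X m (f a) (f a')" using 1 fe ab by blast
      have m': "prod_step (map ugraph (xs @ ys)) m (f a @ g b) (f a' @ g b)"
        using prod_step_append_left[OF m gP[OF ab(2)]] by simp
      have "m < length xs" using m by (simp add: prod_step_def)
      then have "sgn (sprod_list (xs @ ys)) {f a @ g b, f a' @ g b} = sgn (sprod_list xs) {f a, f a'}"
        using sgn_sprod[OF wfxy m'] sgn_sprod[OF wf(3) m] lf ab by (simp add: nth_append)
      moreover have "sgn A {a, a'} = h a * h a' * sgn (sprod_list xs) {f a, f a'}"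
        using f 1 by (simp add: equiv_via_def)
      ultimately show ?thesis using sg 1 k[OF ab(2)] by (auto simp: z)
    next
      case 2
      obtain m where m: "prod_step ?Y m (g b) (g b')" using 2 ge ab by blast
      have m': "prod_step (map ugraph (xs @ ys)) (length xs + m) (f a @ g b) (f a @ g b')"
        using prod_step_append_right[OF m fP[OF ab(1)]] by simp
      have "sgn (sprod_list (xs @ ys)) {f a @ g b, f a @ g b'} = sgn (sprod_list ys) {g b, g b'}"
        using sgn_sprod[OF wfxy m'] sgn_sprod[OF wf(4) m] lf ab by (simp add: nth_append)
      moreover have "sgn B {b, b'} = k b * k b' * sgn (sprod_list ys) {g b, g b'}"
        using g 2 by (simp add: equiv_via_def)
      ultimately show ?thesis using sg 2 h[OF ab(1)] by (auto simp: z)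
    qed
  qed
  moreover have "h (z ! 0) * k (z ! 1) \<in> {1, -1}" if zP: "z \<in> sverts (sprod_list [A, B])" for z
  proof -
    obtain a b where "z = [a, b]" "a \<in> sverts A" "b \<in> sverts B"
      using zP unfolding ugraph_sprod gverts_gprod list.map P by blast
    then show ?thesis using h[of a] k[of b] by auto
  qed
  ultimately show ?thesis unfolding equiv_via_def by blast
qed

section \<open>Existence of a prime decomposition\<close>

lemma card_prod_verts_pair: "card (prod_verts [G, H]) = card (gverts G) * card (gverts H)"
proof -
  have "prod_verts [G, H] = (\<lambda>(a, b). [a, b]) ` (gverts G \<times> gverts H)" by (auto simp: prod_verts_pair)
  then show ?thesis by (simp add: card_image inj_on_def card_cartesian_product)
qed

text \<open>Each factor of a splitting has at least two vertices, so each is strictly smaller than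
  the product. It is again connected and on \<open>nat\<close>, and has an edge, hence the induction
  hypothesis applies to it.\<close>

lemma ex_prime_factors:
  fixes T :: "nat sgraph"
  assumes "wf_sgraph T" "connected_graph (ugraph T)" "sedges T \<noteq> {}"
  shows "\<exists>xs :: nat sgraph list. xs \<noteq> [] \<and> (\<forall>S\<in>set xs. wf_sgraph S \<and> sedges S \<noteq> {} \<and> s_prime S) \<and>
    (\<exists>f h. equiv_via f h T (sprod_list xs))"
  using assms
proof (induction "card (sverts T)" arbitrary: T rule: less_induct)
  case less
  show ?case
  proof (cases "s_prime T")
    case True
    then show ?thesis using equiv_via_sprod_singleton[OF less.prems(1)] less.prems by (intro exI[of _ "[T]"]) auto
  next
    case False
    then obtain A B :: "nat sgraph" where AB: "wf_sgraph A" "wf_sgraph B" "card (sverts A) \<ge> 2" "card (sverts B) \<ge> 2"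
      and eq: "s_equiv T (sprod_list [A, B])" unfolding s_prime_def by blast
    obtain f h where via: "equiv_via f h T (sprod_list [A, B])"
      using eq s_equiv_iff_equiv_via[OF less.prems(1)] by blast
    note f = equiv_via_iso[OF via, unfolded ugraph_sprod]
    note wfT = wf_sgraph_wf_graph[OF less.prems(1)]
    have conn: "connected_graph (gprod_list (map ugraph [A, B]))"
      using connected_graph_iso[OF f wfT less.prems(2)] .
    have cA: "connected_graph (ugraph A)" and cB: "connected_graph (ugraph B)"
      using connected_factor[OF conn, of 0] connected_factor[OF conn, of 1] by simp_all
    have "card (sverts T) = card (sverts A) * card (sverts B)"
      using bij_betw_same_card[of f "sverts T" "prod_verts (map ugraph [A, B])"] f card_prod_verts_pair[of "ugraph A" "ugraph B"]
      by (simp add: graph_iso_def)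
    then have cards: "card (sverts A) < card (sverts T)" "card (sverts B) < card (sverts T)" using AB(3,4) by simp_all
    from less.hyps[OF cards(1) AB(1) cA connected_graph_edges[OF cA AB(3)]]
    obtain xs :: "nat sgraph list" where xs: "xs \<noteq> [] \<and> (\<forall>S\<in>set xs. wf_sgraph S \<and> sedges S \<noteq> {} \<and> s_prime S) \<and>
      (\<exists>f h. equiv_via f h A (sprod_list xs))" ..
    then obtain f1 h1 where v1: "equiv_via f1 h1 A (sprod_list xs)" by blast
    from less.hyps[OF cards(2) AB(2) cB connected_graph_edges[OF cB AB(4)]]
    obtain ys :: "nat sgraph list" where ys: "ys \<noteq> [] \<and> (\<forall>S\<in>set ys. wf_sgraph S \<and> sedges S \<noteq> {} \<and> s_prime S) \<and>
      (\<exists>f h. equiv_via f h B (sprod_list ys))" ..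
    then obtain f2 h2 where v2: "equiv_via f2 h2 B (sprod_list ys)" by blast
    have wfxy: "\<forall>S\<in>set xs. wf_sgraph S" "\<forall>S\<in>set ys. wf_sgraph S" using xs ys by blast+
    note equiv_via_trans[OF via equiv_via_sprod_append[OF AB(1,2) wfxy v1 v2] wfT]
    then show ?thesis using xs ys by (intro exI[of _ "xs @ ys"] conjI) auto
  qed
qed

section \<open>Ordinary graphs as all-positive signed graphs\<close>

lemma s_prime_all_positive:
  assumes "prime_graph G"
  shows "s_prime (G, \<lambda>_. 1)"
  unfolding s_prime_def
proof
  assume "\<exists>A B :: nat sgraph. wf_sgraph A \<and> wf_sgraph B \<and> 2 \<le> card (sverts A) \<and> 2 \<le> card (sverts B) \<and>
    s_equiv (G, \<lambda>_. 1) (sprod_list [A, B])"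
  then obtain A B :: "nat sgraph" where AB: "wf_sgraph A" "wf_sgraph B" "2 \<le> card (sverts A)" "2 \<le> card (sverts B)"
    "s_equiv (G, \<lambda>_. 1) (sprod_list [A, B])" by blast
  \<comment> \<open>Forgetting the signs turns a splitting of the signed graph into one of the
    graph.\<close>
  then have "isomorphic G (gprod_list [ugraph A, ugraph B])"
    by (auto simp: s_equiv_def isomorphic_def ugraph_def sprod_list_def)
  then show False using assms AB wf_sgraph_wf_graph unfolding prime_graph_def by blast
qed

text \<open>With all signs positive every isomorphism between the products is an equivalence without
  switching. The grouping result then applies with the prime graphs of \<open>D\<close> on one side
  and, on the other, the underlying graphs of \<open>Ts\<close>, which may well be
  composite.\<close>

lemma prime_decomp_finer:
  assumes wfT: "\<forall>T\<in>set Ts. wf_sgraph T \<and> sedges T \<noteq> {}" and ne: "Ts \<noteq> []"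
    and D: "prime_graph_decomp G D" and G: "wf_graph G" "connected_graph G"
    and f: "graph_iso f G (gprod_list (map ugraph Ts))"
  shows "finer D (image_mset ugraph (mset Ts))"
proof -
  obtain Gs :: "nat graph list" and g where Gs: "mset Gs = D" and g: "graph_iso g G (gprod_list Gs)"
    using D unfolding prime_graph_decomp_def graph_decomp_def isomorphic_def by blast
  have DGs: "\<forall>H\<in>set Gs. wf_graph H \<and> gedges H \<noteq> {} \<and> prime_graph H"
    using D Gs unfolding prime_graph_decomp_def graph_decomp_def by auto
  define pos :: "nat graph \<Rightarrow> nat sgraph" where "pos = (\<lambda>H. (H, \<lambda>_. 1))"
  have pos: "ugraph (pos H) = H" "sgn (pos H) e = 1" for H e
    by (simp_all add: pos_def ugraph_def sgn_def)
  have wfpos: "wf_sgraph (pos H)" if "wf_graph H" for H using that by (simp add: wf_sgraph_def pos)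
  let ?Ss = "map pos Gs" and ?Ts = "map (\<lambda>T. pos (ugraph T)) Ts"
  have uS: "map ugraph ?Ss = Gs" and uT: "map ugraph ?Ts = map ugraph Ts" by (simp_all add: pos comp_def)
  have wfS: "\<forall>S\<in>set ?Ss. wf_sgraph S" using DGs wfpos by auto
  have wfT': "\<forall>T\<in>set ?Ts. wf_sgraph T \<and> sedges T \<noteq> {}" using wfT wfpos by (auto simp: pos wf_sgraph_def)
  have primes: "\<forall>S\<in>set ?Ss. s_prime S" using DGs s_prime_all_positive by (auto simp: pos_def)
  let ?k = "f \<circ> inv_into (gverts G) g"
  have k: "graph_iso ?k (gprod_list Gs) (gprod_list (map ugraph Ts))"
    by (rule graph_iso_comp[OF graph_iso_inv[OF g] f])
  have one: "sgn (sprod_list Ls) {x, y} = 1"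
    if Ls: "\<forall>L\<in>set Ls. wf_sgraph L \<and> (\<forall>e. sgn L e = 1)" and xy: "{x, y} \<in> sedges (sprod_list Ls)" for Ls :: "nat sgraph list" and x y
  proof -
    obtain i where i: "prod_step (map ugraph Ls) i x y" using xy by (auto simp: gprod_edge_iff)
    then have "Ls ! i \<in> set Ls" by (simp add: prod_step_def)
    then show ?thesis using sgn_sprod[OF _ i] Ls by simp
  qed
  have "equiv_via ?k (\<lambda>_. 1) (sprod_list ?Ss) (sprod_list ?Ts)"
    unfolding equiv_via_def
  proof (intro conjI allI impI)
    show iso: "graph_iso ?k (ugraph (sprod_list ?Ss)) (ugraph (sprod_list ?Ts))"
      using k by (simp only: ugraph_sprod uS uT)
    fix x y assume e: "{x, y} \<in> sedges (sprod_list ?Ss)"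
    have wfP: "wf_graph (ugraph (sprod_list ?Ss))" unfolding ugraph_sprod uS using DGs by (intro wf_gprod) blast
    have "{?k x, ?k y} \<in> sedges (sprod_list ?Ts)"
      using graph_iso_edge_iff[OF iso] wf_graph_edgeD[OF wfP e] e by blast
    then show "sgn (sprod_list ?Ss) {x, y} = 1 * 1 * sgn (sprod_list ?Ts) {?k x, ?k y}"
      using one[OF _ e] one[of ?Ts "?k x" "?k y"] wfS wfT' pos by auto
  qed simp
  moreover have "connected_graph (ugraph (sprod_list ?Ss))"
    unfolding ugraph_sprod uS using connected_graph_iso[OF g G] .
  ultimately obtain \<pi> where \<pi>: "\<forall>i<length Gs. \<pi> i < length Ts"
    and grp: "\<And>j. j < length Ts \<Longrightarrow> filter (\<lambda>i. \<pi> i = j) [0..<length Gs] \<noteq> [] \<and>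
      isomorphic (ugraph (?Ts ! j)) (gprod_list (map ((!) Gs) (filter (\<lambda>i. \<pi> i = j) [0..<length Gs])))"
    using s_prime_factors_group[OF wfS wfT' _ primes, of ?k "\<lambda>_. 1"] ne unfolding uS length_map map_is_Nil_conv by blast
  \<comment> \<open>The group of \<open>j\<close> consists of the prime factors whose layers lie in
    layer \<open>j\<close>; its product is the graph of the factor \<open>j\<close>.\<close>
  define ds where "ds = map (\<lambda>j. mset (map ((!) Gs) (filter (\<lambda>i. \<pi> i = j) [0..<length Gs]))) [0..<length Ts]"
  have "graph_decomp (map ugraph Ts ! j) (ds ! j)" if j: "j < length Ts" for j
  proof -
    have "ds ! j = mset (map ((!) Gs) (filter (\<lambda>i. \<pi> i = j) [0..<length Gs]))" using j by (simp add: ds_def)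
    moreover have "isomorphic (map ugraph Ts ! j) (gprod_list (map ((!) Gs) (filter (\<lambda>i. \<pi> i = j) [0..<length Gs])))"
      using grp[OF j] j by (simp add: pos)
    moreover have "\<forall>H\<in>set (map ((!) Gs) (filter (\<lambda>i. \<pi> i = j) [0..<length Gs])). wf_graph H \<and> gedges H \<noteq> {}"
      using DGs by auto
    ultimately show ?thesis using grp[OF j] unfolding graph_decomp_def by (metis map_is_Nil_conv mset_zero_iff set_mset_mset)
  qed
  moreover have "sum_list ds = D"
    using sum_list_mset_filter[of "[0..<length Gs]" \<pi> "length Ts" "(!) Gs"] \<pi> Gs by (simp add: ds_def map_nth)
  ultimately show ?thesis unfolding finer_def
    by (intro exI[of _ "map ugraph Ts"] exI[of _ ds]) (simp add: ds_def)
qed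

theorem theorem4p9:
  fixes S :: "'v sgraph" and D :: "nat graph multiset"
  assumes "wf_sgraph S"
    and "connected_graph (ugraph S)"
    and "prime_graph_decomp (ugraph S) D"
  shows "\<exists>Ds. prime_s_decomp S Ds \<and>
           (\<forall>Ds'. prime_s_decomp S Ds' \<longrightarrow> rel_mset s_equiv Ds Ds') \<and>
           finer D (image_mset ugraph Ds)"
proof -
  note wfS = wf_sgraph_wf_graph[OF assms(1)]
  obtain Gs :: "nat graph list" and g where Gs': "mset Gs = D" and g: "graph_iso g (ugraph S) (gprod_list Gs)"
    using assms(3) unfolding prime_graph_decomp_def graph_decomp_def isomorphic_def by blast
  have Gs: "Gs \<noteq> []" "\<forall>H\<in>set Gs. wf_graph H \<and> gedges H \<noteq> {}"
    using assms(3) unfolding prime_graph_decomp_def graph_decomp_def Gs'[symmetric] by auto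
  \<comment> \<open>The factors of \<open>D\<close> have edges, so the product contains a layer with
    an edge. This excludes the one-vertex graph, which admits no decomposition.\<close>
  have "sedges S \<noteq> {}"
  proof -
    obtain a where "a \<in> sverts S" using assms(2) by (auto simp: connected_graph_def)
    then have a: "g a \<in> prod_verts Gs" using graph_iso_mem[OF g] by simp
    have G0: "wf_graph (Gs ! 0)" "gedges (Gs ! 0) \<noteq> {}" using Gs by simp_all
    then obtain u v where uv: "{u, v} \<in> gedges (Gs ! 0)" "u \<in> gverts (Gs ! 0)" "v \<in> gverts (Gs ! 0)"
      using wf_graph_edgeE by (metis all_not_in_conv)
    have wfG: "\<forall>G\<in>set Gs. wf_graph G" using Gs by blast
    have e: "{(g a)[0 := u], (g a)[0 := v]} \<in> gedges (gprod_list Gs)"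
      using gprod_edge_update_iff(1)[OF wfG a _ uv(2,3)] uv(1) Gs(1) by simp
    let ?r = "inv_into (sverts S) g"
    have "{?r ((g a)[0 := u]), ?r ((g a)[0 := v])} \<in> sedges S"
      using graph_iso_edge_iff[OF graph_iso_inv[OF g]] prod_verts_update[OF a] uv(2,3) e by simp
    then show ?thesis by blast
  qed
  \<comment> \<open>Existence was proved by an induction that stays on \<open>nat\<close>, so
    \<open>S\<close> is first copied there.\<close>
  obtain p :: "'v \<Rightarrow> nat" where p: "inj_on p (sverts S)"
    using finite_inj_nat wfS unfolding wf_graph_def by blast
  define T where "T = push_sgraph p S"
  have T: "wf_sgraph T" "equiv_via p (\<lambda>_. 1) S T" using push_sgraph[OF assms(1) p] by (simp_all add: T_def)
  note pi = equiv_via_iso[OF T(2)]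
  have "sedges T \<noteq> {}"
  proof -
    obtain u v where "{u, v} \<in> sedges S" "u \<in> sverts S" "v \<in> sverts S"
      using \<open>sedges S \<noteq> {}\<close> wf_graph_edgeE[OF wfS] by (metis all_not_in_conv)
    then show ?thesis using graph_iso_edge_iff[OF pi] by blast
  qed
  then obtain Ts :: "nat sgraph list" and f h where Ts: "Ts \<noteq> []" "\<forall>U\<in>set Ts. wf_sgraph U \<and> sedges U \<noteq> {} \<and> s_prime U"
    and via: "equiv_via f h T (sprod_list Ts)"
    using ex_prime_factors[OF T(1) connected_graph_iso[OF pi wfS assms(2)]] by blast
  obtain f' h' where via': "equiv_via f' h' S (sprod_list Ts)" using equiv_via_trans[OF T(2) via wfS] by blast
  have "s_equiv S (sprod_list Ts)" using via' s_equiv_iff_equiv_via[OF assms(1)] by blast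
  then have "prime_s_decomp S (mset Ts)"
    using Ts unfolding prime_s_decomp_def s_decomp_def by auto
  moreover have "rel_mset s_equiv (mset Ts) Ds'" if Ds': "prime_s_decomp S Ds'" for Ds'
  proof -
    obtain Us :: "nat sgraph list" where Us: "mset Us = Ds'" "s_equiv S (sprod_list Us)"
      using Ds' unfolding prime_s_decomp_def s_decomp_def by blast
    have U: "\<forall>U\<in>set Us. wf_sgraph U \<and> sedges U \<noteq> {}" "\<forall>U\<in>set Us. s_prime U" "Us \<noteq> []"
      using Ds' unfolding prime_s_decomp_def s_decomp_def Us(1)[symmetric] by auto
    obtain f2 h2 where v2: "equiv_via f2 h2 S (sprod_list Us)" using Us(2) s_equiv_iff_equiv_via[OF assms(1)] by blast
    have wfP: "wf_graph (ugraph (sprod_list Ts))"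
      unfolding ugraph_sprod using Ts(2) by (intro wf_gprod) (auto simp: wf_sgraph_def)
    have "connected_graph (ugraph (sprod_list Ts))"
      using connected_graph_iso[OF equiv_via_iso[OF via'] wfS assms(2)] .
    \<comment> \<open>The two products are compared through \<open>S\<close>: back along
      \<open>f'\<close> and forward along \<open>f2\<close>.\<close>
    then have "rel_mset s_equiv (mset Ts) (mset Us)"
      using s_prime_factors_unique[OF _ U(1) Ts(1) U(3) _ U(2) equiv_via_trans[OF equiv_via_sym[OF via' wfP] v2 wfP]] Ts(2)
      by blast
    then show ?thesis using Us(1) by simp
  qed
  moreover have "finer D (image_mset ugraph (mset Ts))"
    using prime_decomp_finer[OF _ Ts(1) assms(3) wfS assms(2) equiv_via_iso[OF via', unfolded ugraph_sprod]] Ts(2) by blast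
  ultimately show ?thesis by blast
qed

end
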